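(* Let $E$ be an AL-space and let $\mathcal{T} = (T_t)_{t \in J}$ be a bounded positive semigroup on $E$, where either $J = \mathbb{N}$ or $J = (0,\infty)$. Suppose that for every $t \in J$ the adjoint operator $T_t'$ on the dual space $E'$ is a lattice homomorphism. Then the following assertions are equivalent: (i) $\mathcal{T}$ is strongly convergent (as $t\to\infty$) and the limit operator $P$ fulfils $Pf > 0$ for every $f > 0$. (ii) For every $0<f \in E$ there exists a non-zero lower bound $h_f$ for $(\mathcal{T},f)$.
   Context: All spaces are real. $\mathbb{N} = \{1,2,\dots\}$. An AL-space is a Banach lattice $E$ with $\|f+g\| = \|f\|+\|g\|$ for all $f,g \in E_+$, where $E_+$ is the positive cone. $f>0$ means $f\ge 0$ and $f \ne 0$. A semigroup on $E$ is a family $(T_t)_{t \in J}$ of bounded linear operators on $E$ with $T_{t+s} = T_tT_s$ for all $s,t \in J$; no continuity in $t$ is assumed. It is bounded if $\sup_{t\in J}\|T_t\|<\infty$, and positive if $T_tE_+\subseteq E_+$ for all $t \in J$. Strongly convergent means convergent in the strong operator topology to a bounded linear operator. For $f \in E_+$, a lower bound for $(\mathcal{T},f)$ is a vector $h_f \in E_+$ such that $\lim_{t\to\infty}\|(T_tf-h_f)^-\| = 0$; here $g^- = (-g)\vee 0$. *)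

theory Defs
  imports "HOL-Analysis.Analysis" "HOL-Library.Lattice_Algebras"
begin

section \<open>Banach lattices and AL-spaces\<close>

text \<open>
  The modulus of \<open>x\<close> is written \<open>sup x (- x)\<close>, so that no separate \<open>abs\<close>
  operation is needed.
\<close>

class banach_lattice = banach + ordered_real_vector + lattice_ab_group_add +
  assumes norm_le_of_modulus_le: "sup x (- x) \<le> sup y (- y) \<Longrightarrow> norm x \<le> norm y"

class al_space = banach_lattice +
  assumes norm_add_of_nonneg: "0 \<le> x \<Longrightarrow> 0 \<le> y \<Longrightarrow> norm (x + y) = norm x + norm y"

definition neg_part :: "'a::banach_lattice \<Rightarrow> 'a"
  where "neg_part x = sup (- x) 0"


section \<open>The dual Banach lattice\<close>

definition dual_le :: "('a::banach_lattice \<Rightarrow>\<^sub>L real) \<Rightarrow> ('a \<Rightarrow>\<^sub>L real) \<Rightarrow> bool"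
  where "dual_le \<phi> \<psi> \<longleftrightarrow> (\<forall>x\<ge>0. \<phi> x \<le> \<psi> x)"

definition is_dual_sup ::
    "('a::banach_lattice \<Rightarrow>\<^sub>L real) \<Rightarrow> ('a \<Rightarrow>\<^sub>L real) \<Rightarrow> ('a \<Rightarrow>\<^sub>L real) \<Rightarrow> bool"
  where "is_dual_sup \<phi> \<psi> \<sigma> \<longleftrightarrow> dual_le \<phi> \<sigma> \<and> dual_le \<psi> \<sigma> \<and>
    (\<forall>\<rho>. dual_le \<phi> \<rho> \<longrightarrow> dual_le \<psi> \<rho> \<longrightarrow> dual_le \<sigma> \<rho>)"

text \<open>Existence and uniqueness of the supremum is lemma \<open>is_dual_sup_dual_sup\<close> below.\<close>

definition dual_sup ::
    "('a::banach_lattice \<Rightarrow>\<^sub>L real) \<Rightarrow> ('a \<Rightarrow>\<^sub>L real) \<Rightarrow> ('a \<Rightarrow>\<^sub>L real)"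
  where "dual_sup \<phi> \<psi> = (THE \<sigma>. is_dual_sup \<phi> \<psi> \<sigma>)"

definition dual_operator ::
    "('a::banach_lattice \<Rightarrow>\<^sub>L 'a) \<Rightarrow> ('a \<Rightarrow>\<^sub>L real) \<Rightarrow> ('a \<Rightarrow>\<^sub>L real)"
  where "dual_operator T \<phi> = \<phi> o\<^sub>L T"

text \<open>Since the operator is linear, preservation of infima follows from that of suprema.\<close>

definition dual_lattice_hom ::
    "(('a::banach_lattice \<Rightarrow>\<^sub>L real) \<Rightarrow> ('a \<Rightarrow>\<^sub>L real)) \<Rightarrow> bool"
  where "dual_lattice_hom S \<longleftrightarrow> linear S \<and>
    (\<forall>\<phi> \<psi>. S (dual_sup \<phi> \<psi>) = dual_sup (S \<phi>) (S \<psi>))"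


subsection \<open>Existence of suprema in the dual\<close>

lemma bl_modulus_nonneg: "0 \<le> sup x (- x)" for x :: "'a::banach_lattice"
proof -
  have "x + (- x) \<le> sup x (- x) + sup x (- x)" by (rule add_mono) simp_all
  then show ?thesis by simp
qed

lemma bl_norm_mono: "0 \<le> y \<Longrightarrow> y \<le> x \<Longrightarrow> norm y \<le> norm x"
  for x y :: "'a::banach_lattice"
proof (rule norm_le_of_modulus_le)
  assume "0 \<le> y" "y \<le> x"
  then have "- y \<le> y" by (meson neg_le_0_iff_le order_trans)
  then have "sup y (- y) = y" by (simp add: sup_absorb1)
  also have "y \<le> sup x (- x)" using \<open>y \<le> x\<close> by (rule le_supI1)
  finally show "sup y (- y) \<le> sup x (- x)" .
qed

lemma bl_norm_pprt: "norm (pprt x) \<le> norm x" for x :: "'a::banach_lattice"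
proof (rule norm_le_of_modulus_le)
  have "0 \<le> pprt x" by simp
  then have "- pprt x \<le> pprt x" by (meson neg_le_0_iff_le order_trans)
  then have "sup (pprt x) (- pprt x) = pprt x" by (simp add: sup_absorb1)
  also have "pprt x \<le> sup x (- x)"
    unfolding pprt_def by (rule sup_least) (simp_all add: bl_modulus_nonneg)
  finally show "sup (pprt x) (- pprt x) \<le> sup x (- x)" .
qed

lemma bl_norm_nprt: "norm (nprt x) \<le> norm x" for x :: "'a::banach_lattice"
  using bl_norm_pprt[of "- x"] by (simp add: pprt_neg)

lemma bl_riesz_decomposition:
  fixes x y z :: "'a::banach_lattice"
  assumes "0 \<le> x" "0 \<le> y" "0 \<le> z" "z \<le> x + y"
  obtains a b where "z = a + b" "0 \<le> a" "a \<le> x" "0 \<le> b" "b \<le> y"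
proof
  show "z = inf z x + (z - inf z x)" by (metis add.commute diff_add_cancel)
  show "0 \<le> inf z x" using assms by simp
  show "0 \<le> z - inf z x" by (simp only: diff_ge_0_iff_ge inf_le1)
  have "z - y \<le> inf z x" using assms by (simp add: algebra_simps)
  then show "z - inf z x \<le> y" by (metis diff_le_eq add.commute)
qed simp

definition dual_pos_part_cone :: "('a::banach_lattice \<Rightarrow>\<^sub>L real) \<Rightarrow> 'a \<Rightarrow> real"
  where "dual_pos_part_cone \<eta> x = (SUP y\<in>{0..x}. \<eta> y)"

context
  fixes \<eta> :: "'a::banach_lattice \<Rightarrow>\<^sub>L real"
begin

private abbreviation "p \<equiv> dual_pos_part_cone \<eta>"

private lemma p_bound: "0 \<le> y \<Longrightarrow> y \<le> x \<Longrightarrow> \<eta> y \<le> norm \<eta> * norm x"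
  by (smt (verit) norm_blinfun bl_norm_mono mult_left_mono norm_ge_zero real_norm_def)

private lemma p_upper: "0 \<le> y \<Longrightarrow> y \<le> x \<Longrightarrow> \<eta> y \<le> p x"
  unfolding dual_pos_part_cone_def
  by (rule cSUP_upper) (auto intro!: bdd_aboveI[where M = "norm \<eta> * norm x"] p_bound)

private lemma p_least: "0 \<le> x \<Longrightarrow> (\<And>y. 0 \<le> y \<Longrightarrow> y \<le> x \<Longrightarrow> \<eta> y \<le> c) \<Longrightarrow> p x \<le> c"
  unfolding dual_pos_part_cone_def by (rule cSUP_least) auto

private lemma p_nonneg: "0 \<le> x \<Longrightarrow> 0 \<le> p x"
  using p_upper[of 0 x] by simp

private lemma p_add:
  assumes "0 \<le> x" "0 \<le> y" shows "p (x + y) = p x + p y"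
proof (rule antisym)
  show "p (x + y) \<le> p x + p y"
  proof (rule p_least)
    fix z assume "0 \<le> z" "z \<le> x + y"
    with assms obtain a b where "z = a + b" "0 \<le> a" "a \<le> x" "0 \<le> b" "b \<le> y"
      by (rule bl_riesz_decomposition)
    then show "\<eta> z \<le> p x + p y"
      by (simp add: blinfun.add_right add_mono p_upper)
  qed (use assms in simp)
  have "\<eta> a + \<eta> b \<le> p (x + y)" if "0 \<le> a" "a \<le> x" "0 \<le> b" "b \<le> y" for a b
    using that p_upper[of "a + b" "x + y"] by (simp add: blinfun.add_right add_mono)
  then have "p y \<le> p (x + y) - \<eta> a" if "0 \<le> a" "a \<le> x" for a
    using that assms by (intro p_least) (auto simp only: le_diff_eq add.commute[of _ "\<eta> a"])
  then have "p x \<le> p (x + y) - p y"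
    using assms by (intro p_least) (auto simp: algebra_simps)
  then show "p x + p y \<le> p (x + y)" by simp
qed

private lemma p_scale_le:
  assumes "0 \<le> x" "0 < c" shows "p (c *\<^sub>R x) \<le> c * p x"
proof (rule p_least)
  fix y assume y: "0 \<le> y" "y \<le> c *\<^sub>R x"
  have "\<eta> (inverse c *\<^sub>R y) \<le> p x"
  proof (rule p_upper)
    show "0 \<le> inverse c *\<^sub>R y" using y assms by (simp add: scaleR_nonneg_nonneg)
    have "inverse c *\<^sub>R y \<le> inverse c *\<^sub>R (c *\<^sub>R x)"
      using y assms by (intro scaleR_left_mono) auto
    then show "inverse c *\<^sub>R y \<le> x" using assms by simp
  qed
  then show "\<eta> y \<le> c * p x" using assms by (simp add: blinfun.scaleR_right field_simps)
qed (use assms in \<open>simp add: scaleR_nonneg_nonneg\<close>)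

private lemma p_scale:
  assumes "0 \<le> x" "0 \<le> c" shows "p (c *\<^sub>R x) = c * p x"
proof (cases "c = 0")
  case True
  have "p 0 = 0" using p_add[of 0 0] by simp
  with True show ?thesis by simp
next
  case False
  then have c: "0 < c" using assms by simp
  have "p (inverse c *\<^sub>R (c *\<^sub>R x)) \<le> inverse c * p (c *\<^sub>R x)"
    using c assms by (intro p_scale_le) (auto simp: scaleR_nonneg_nonneg)
  then have "c * p x \<le> p (c *\<^sub>R x)" using c by (simp add: field_simps)
  with p_scale_le[OF assms(1) c] show ?thesis by simp
qed

private definition "ext x = p (pprt x) - p (- nprt x)"

private lemma ext_diff: assumes "0 \<le> u" "0 \<le> v" shows "ext (u - v) = p u - p v"
proof -
  define x where "x = u - v"
  have "pprt x + v = u + - nprt x"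
    using prts[of x] unfolding x_def by (simp add: algebra_simps)
  then have "p (pprt x) + p v = p u + p (- nprt x)"
    using assms p_add[of "pprt x" v] p_add[of u "- nprt x"] by simp
  then show ?thesis unfolding ext_def x_def by simp
qed

private lemma ext_nonneg_eq: "0 \<le> x \<Longrightarrow> ext x = p x"
  using ext_diff[of x 0] p_add[of 0 0] by simp

private lemma ext_bounded_linear: "bounded_linear ext"
proof (rule bounded_linear_intro[where K = "norm \<eta>"])
  fix x y :: 'a and c :: real
  have x: "x = pprt x - (- nprt x)" and y: "y = pprt y - (- nprt y)"
    using prts[of x] prts[of y] by simp_all
  have "x + y = (pprt x + pprt y) - (- nprt x + - nprt y)"
    using arg_cong2[OF x y, of "(+)"] by (simp add: ac_simps)
  then have "ext (x + y) = p (pprt x + pprt y) - p (- nprt x + - nprt y)"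
    using ext_diff[of "pprt x + pprt y" "- nprt x + - nprt y"]
    by (metis add_nonneg_nonneg zero_le_pprt nprt_le_zero neg_0_le_iff_le)
  also have "\<dots> = ext x + ext y"
    using p_add[of "pprt x" "pprt y"] p_add[of "- nprt x" "- nprt y"] by (simp add: ext_def)
  finally show "ext (x + y) = ext x + ext y" .
  show "ext (c *\<^sub>R x) = c *\<^sub>R ext x"
  proof (cases "0 \<le> c")
    case True
    have "c *\<^sub>R x = c *\<^sub>R pprt x - c *\<^sub>R (- nprt x)"
      using x by (metis scaleR_diff_right)
    then have "ext (c *\<^sub>R x) = p (c *\<^sub>R pprt x) - p (c *\<^sub>R (- nprt x))"
      using ext_diff[of "c *\<^sub>R pprt x" "c *\<^sub>R (- nprt x)"] True
      by (metis scaleR_nonneg_nonneg zero_le_pprt nprt_le_zero neg_0_le_iff_le)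
    then show ?thesis
      using True p_scale[of "pprt x" c] p_scale[of "- nprt x" c]
      by (simp add: ext_def right_diff_distrib del: scaleR_minus_right)
  next
    case False
    have "c *\<^sub>R x = (- c) *\<^sub>R (- nprt x) - (- c) *\<^sub>R pprt x"
      using arg_cong[OF x, of "scaleR c"] by (simp add: algebra_simps)
    moreover have "0 \<le> (- c) *\<^sub>R (- nprt x)" "0 \<le> (- c) *\<^sub>R pprt x"
      using False by (intro scaleR_nonneg_nonneg; simp)+
    ultimately have "ext (c *\<^sub>R x) = p ((- c) *\<^sub>R (- nprt x)) - p ((- c) *\<^sub>R pprt x)"
      using ext_diff[of "(- c) *\<^sub>R (- nprt x)" "(- c) *\<^sub>R pprt x"] by metis
    then show ?thesis
      using False p_scale[of "pprt x" "- c"] p_scale[of "- nprt x" "- c"]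
      by (simp add: ext_def algebra_simps del: scaleR_minus_right scaleR_minus_left)
  qed
  have "p u \<le> norm \<eta> * norm u" if "0 \<le> u" for u
    using that by (intro p_least p_bound)
  then have "p (pprt x) \<le> norm \<eta> * norm (pprt x)" "p (- nprt x) \<le> norm \<eta> * norm (- nprt x)"
    by (metis zero_le_pprt, metis nprt_le_zero neg_0_le_iff_le)
  moreover have "norm \<eta> * norm (pprt x) \<le> norm \<eta> * norm x"
    "norm \<eta> * norm (- nprt x) \<le> norm \<eta> * norm x"
    by (simp_all add: bl_norm_pprt bl_norm_nprt mult_left_mono)
  moreover have "0 \<le> p (pprt x)" "0 \<le> p (- nprt x)" by (simp_all add: p_nonneg)
  ultimately have "norm (ext x) \<le> norm \<eta> * norm x"
    unfolding ext_def real_norm_def abs_le_iff by linarith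
  then show "norm (ext x) \<le> norm x * norm \<eta>" by (simp only: mult.commute)
qed

lemma ex_is_dual_sup_zero: "\<exists>\<sigma>. is_dual_sup \<eta> 0 \<sigma>"
proof -
  have "is_dual_sup \<eta> 0 (Blinfun ext)"
    unfolding is_dual_sup_def dual_le_def
    by (auto simp: bounded_linear_Blinfun_apply[OF ext_bounded_linear] ext_nonneg_eq
        p_upper p_nonneg) (smt (verit) p_least ext_nonneg_eq blinfun.diff_right diff_ge_0_iff_ge)
  then show ?thesis ..
qed

end

lemma dual_le_antisym:
  assumes "dual_le \<phi> \<psi>" "dual_le \<psi> \<phi>" shows "\<phi> = \<psi>"
proof (rule blinfun_eqI)
  fix x
  have eq: "\<phi> y = \<psi> y" if "0 \<le> y" for y
    using assms that by (auto simp: dual_le_def intro: antisym)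
  have "\<phi> (pprt x) - \<phi> (- nprt x) = \<psi> (pprt x) - \<psi> (- nprt x)"
    using eq[of "pprt x"] eq[of "- nprt x"] by simp
  then have "\<phi> (pprt x - (- nprt x)) = \<psi> (pprt x - (- nprt x))"
    by (simp only: blinfun.diff_right)
  then show "\<phi> x = \<psi> x" using prts[of x] by simp
qed

lemma ex1_is_dual_sup: "\<exists>!\<sigma>. is_dual_sup \<phi> \<psi> \<sigma>"
proof (rule ex_ex1I)
  obtain \<tau> where \<tau>: "is_dual_sup (\<phi> - \<psi>) 0 \<tau>" using ex_is_dual_sup_zero by blast
  have "is_dual_sup \<phi> \<psi> (\<psi> + \<tau>)"
    unfolding is_dual_sup_def
  proof (intro conjI allI impI)
    show "dual_le \<phi> (\<psi> + \<tau>)" "dual_le \<psi> (\<psi> + \<tau>)"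
      using \<tau> by (auto simp: is_dual_sup_def dual_le_def blinfun.add_left blinfun.diff_left
          algebra_simps)
    fix \<rho> assume "dual_le \<phi> \<rho>" "dual_le \<psi> \<rho>"
    then have "dual_le (\<phi> - \<psi>) (\<rho> - \<psi>)" "dual_le 0 (\<rho> - \<psi>)"
      by (auto simp: dual_le_def blinfun.diff_left)
    then have "dual_le \<tau> (\<rho> - \<psi>)" using \<tau> by (auto simp: is_dual_sup_def)
    then show "dual_le (\<psi> + \<tau>) \<rho>"
      by (auto simp: dual_le_def blinfun.add_left blinfun.diff_left algebra_simps)
  qed
  then show "\<exists>\<sigma>. is_dual_sup \<phi> \<psi> \<sigma>" ..
  show "\<sigma> = \<sigma>'" if "is_dual_sup \<phi> \<psi> \<sigma>" "is_dual_sup \<phi> \<psi> \<sigma>'" for \<sigma> \<sigma>'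
    using that by (auto simp: is_dual_sup_def intro: dual_le_antisym)
qed

lemma is_dual_sup_dual_sup: "is_dual_sup \<phi> \<psi> (dual_sup \<phi> \<psi>)"
  unfolding dual_sup_def by (rule theI') (rule ex1_is_dual_sup)


section \<open>Operator semigroups\<close>

text \<open>
  The time set \<open>J\<close> is a set of reals, so that the discrete case \<open>J = real ` {1..}\<close> and
  the continuous case \<open>J = {0<..}\<close> can be treated uniformly. The values of \<open>T\<close> outside
  \<open>J\<close> are irrelevant.
\<close>

definition operator_semigroup ::
    "real set \<Rightarrow> (real \<Rightarrow> 'a::real_normed_vector \<Rightarrow>\<^sub>L 'a) \<Rightarrow> bool"
  where "operator_semigroup J T \<longleftrightarrow> (\<forall>s\<in>J. \<forall>t\<in>J. T (t + s) = T t o\<^sub>L T s)"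

definition positive_family ::
    "real set \<Rightarrow> (real \<Rightarrow> 'a::banach_lattice \<Rightarrow>\<^sub>L 'a) \<Rightarrow> bool"
  where "positive_family J T \<longleftrightarrow> (\<forall>t\<in>J. \<forall>f\<ge>0. 0 \<le> T t f)"

abbreviation at_top_in :: "real set \<Rightarrow> real filter"
  where "at_top_in J \<equiv> inf at_top (principal J)"

definition strongly_converges_to ::
    "real set \<Rightarrow> (real \<Rightarrow> 'a::real_normed_vector \<Rightarrow>\<^sub>L 'a) \<Rightarrow> ('a \<Rightarrow>\<^sub>L 'a) \<Rightarrow> bool"
  where "strongly_converges_to J T P \<longleftrightarrow> (\<forall>f. ((\<lambda>t. T t f) \<longlongrightarrow> P f) (at_top_in J))"

definition is_lower_bound ::
    "real set \<Rightarrow> (real \<Rightarrow> 'a::banach_lattice \<Rightarrow>\<^sub>L 'a) \<Rightarrow> 'a \<Rightarrow> 'a \<Rightarrow> bool"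
  where "is_lower_bound J T f h \<longleftrightarrow>
    0 \<le> h \<and> ((\<lambda>t. norm (neg_part (T t f - h))) \<longlongrightarrow> 0) (at_top_in J)"

end

theory Submission
  imports Defs
begin

text \<open>
  That (i) implies (ii) is clear, because \<open>P f\<close> is a lower bound for \<open>f\<close>. For the converse, each
  orbit of a vector \<open>g \<ge> 0\<close> converges to the greatest lower bound \<open>h\<close> of \<open>g\<close>, for the
  following reasons.

  The lower bounds of \<open>g\<close> are closed under finite suprema and norm limits, and their norms are
  bounded, so the additivity of the norm provides a greatest one, \<open>h\<close> (lemma
  \<open>greatest_lower_bound\<close>). The operators map lower bounds to lower bounds, so
  \<open>T t h \<le> h\<close>. The nonnegative vector \<open>h - T t h\<close> has an orbit that tends to zero along the
  multiples of \<open>t\<close>; by (ii) only the zero vector does this, so \<open>h\<close> is a fixed point. It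
  remains to show that the orbit of \<open>f = g - h\<close>, whose negative part vanishes asymptotically,
  tends to zero. If \<open>f\<close> were itself nonnegative, then it would be zero: a nonzero lower bound
  \<open>w\<close> of \<open>f\<close> would make \<open>h + w\<close> a lower bound of \<open>g\<close>, against the choice of \<open>h\<close>. The
  hypothesis on the adjoints serves to replace \<open>f\<close> by a nonnegative vector \<open>x\<close> with
  asymptotically the same orbit (lemma \<open>asymptotically_positive_orbit\<close>).

  This works because an operator \<open>T\<close> whose adjoint is a lattice homomorphism is interval
  preserving: it maps the interval \<open>[0, x]\<close> onto \<open>[0, T x]\<close> for each \<open>x \<ge> 0\<close>. Hence one can
  choose \<open>x\<^sub>0 \<ge> x\<^sub>1 \<ge> \<dots> \<ge> 0\<close> such that the operator at the \<open>n\<close>-th time maps \<open>x\<^sub>n\<close> exactly to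
  the positive part of the orbit of \<open>f\<close> at that time. A decreasing sequence of nonnegative vectors
  in an AL-space converges, and its limit is the required \<open>x\<close>.

  Density of \<open>T[0, x]\<close> in \<open>[0, T x]\<close> is a separation argument by the Hahn-Banach theorem, which
  is proved here by taking minimal sublinear functionals. Exactness follows from density by
  approximating with monotone sequences, which converge because the norm is additive on the
  positive cone.
\<close>

section \<open>Sublinear functionals and the Hahn-Banach theorem\<close>

text \<open>
  Homogeneity is required as an inequality, which is all that has to be checked for infima;
  equality and \<open>p 0 = 0\<close> follow by using the inverse scalar.
\<close>
definition sublinear :: "('v::real_vector \<Rightarrow> real) \<Rightarrow> bool"
  where "sublinear p \<longleftrightarrow>
    (\<forall>u v. p (u + v) \<le> p u + p v) \<and> (\<forall>c>0. \<forall>u. p (c *\<^sub>R u) \<le> c * p u)"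

lemma sublinear_add: "sublinear p \<Longrightarrow> p (u + v) \<le> p u + p v"
  by (simp add: sublinear_def)

lemma sublinear_scale:
  assumes "sublinear p" "0 < c" shows "p (c *\<^sub>R u) = c * p u"
proof (rule antisym)
  show "p (c *\<^sub>R u) \<le> c * p u" using assms by (simp add: sublinear_def)
  have "p (inverse c *\<^sub>R (c *\<^sub>R u)) \<le> inverse c * p (c *\<^sub>R u)"
    using assms unfolding sublinear_def by (metis positive_imp_inverse_positive)
  then show "c * p u \<le> p (c *\<^sub>R u)" using assms by (simp add: field_simps)
qed

lemma sublinear_zero: "sublinear p \<Longrightarrow> p 0 = 0"
  using sublinear_scale[of p 2 0] by simp

lemma sublinear_minus: "sublinear p \<Longrightarrow> - p (- u) \<le> p u"
  using sublinear_add[of p u "- u"] sublinear_zero[of p] by simp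

text \<open>
  Any sublinear \<open>p\<close> with \<open>- p a < p (- a)\<close>, that is, with a kink at the line through \<open>a\<close>, can
  be lowered. The new functional is the one-sided derivative of \<open>p\<close> far out in the direction
  \<open>a\<close>: the limit of \<open>p (u + s a) - p (s a)\<close>, which is nonincreasing in \<open>s\<close>, as \<open>s\<close> tends
  to infinity.
\<close>
lemma sublinear_descent:
  assumes p: "sublinear p"
  obtains q where "sublinear q" "\<And>u. q u \<le> p u" "q (- a) \<le> - p a"
proof
  define F where "F u s = p (u + s *\<^sub>R a) - s * p a" for u s
  define q where "q u = (INF s\<in>{0..}. F u s)" for u
  have scale: "p (s *\<^sub>R a) = s * p a" if "0 \<le> s" for s
    using that sublinear_scale[OF p, of s a] sublinear_zero[OF p] by (cases "s = 0") auto
  have "- p (- u) \<le> F u s" if "0 \<le> s" for u s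
    using sublinear_add[OF p, of "u + s *\<^sub>R a" "- u"] scale[OF that] by (simp add: F_def)
  then have bdd: "bdd_below (F u ` {0..})" for u
    by (intro bdd_belowI[where m = "- p (- u)"]) auto
  have q_le: "q u \<le> F u s" if "0 \<le> s" for u s
    unfolding q_def by (rule cINF_lower[OF bdd]) (use that in simp)
  have q_ge: "c \<le> q u" if "\<And>s. 0 \<le> s \<Longrightarrow> c \<le> F u s" for u c
    unfolding q_def by (rule cINF_greatest) (use that in auto)
  have add: "q (u + v) \<le> q u + q v" for u v
  proof -
    have "q (u + v) \<le> F u s + F v t" if "0 \<le> s" "0 \<le> t" for s t
      using q_le[of "s + t" "u + v"] that
        sublinear_add[OF p, of "u + s *\<^sub>R a" "v + t *\<^sub>R a"]
      by (simp add: F_def algebra_simps)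
    then have "q (u + v) - F u s \<le> q v" if "0 \<le> s" for s
      using that by (intro q_ge) (simp add: algebra_simps)
    then have "q (u + v) - q v \<le> q u"
      by (intro q_ge) (simp add: algebra_simps)
    then show ?thesis by simp
  qed
  have "q (c *\<^sub>R u) \<le> c * q u" if "0 < c" for c u
  proof -
    have "q (c *\<^sub>R u) / c \<le> F u s" if "0 \<le> s" for s
      using q_le[of "c * s" "c *\<^sub>R u"] that \<open>0 < c\<close>
        sublinear_scale[OF p \<open>0 < c\<close>, of "u + s *\<^sub>R a"]
      by (simp add: F_def field_simps)
    then have "q (c *\<^sub>R u) / c \<le> q u" by (rule q_ge)
    then show ?thesis using \<open>0 < c\<close> by (simp add: field_simps)
  qed
  with add show "sublinear q" by (simp add: sublinear_def)
  show "q u \<le> p u" for u using q_le[of 0 u] by (simp add: F_def)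
  show "q (- a) \<le> - p a" using q_le[of 1 "- a"] sublinear_zero[OF p] by (simp add: F_def)
qed

text \<open>
  Since \<open>sublinear_descent\<close> cannot lower a minimal functional \<open>q\<close>, such a \<open>q\<close> is odd, and
  an odd sublinear functional is linear.
\<close>
lemma sublinear_minimal_linear:
  assumes q: "sublinear q"
    and min: "\<And>r. sublinear r \<Longrightarrow> (\<And>u. r u \<le> q u) \<Longrightarrow> r = q"
  shows "linear q"
proof -
  have odd: "q (- u) = - q u" for u
  proof -
    obtain r where r: "sublinear r" "\<And>v. r v \<le> q v" "r (- u) \<le> - q u"
      using sublinear_descent[OF q] by blast
    then have "r = q" using min by blast
    with r(3) sublinear_minus[OF q, of u] show ?thesis by simp
  qed
  have "q (u + v) = q u + q v" for u v
    using sublinear_add[OF q, of u v] sublinear_add[OF q, of "- u" "- v"] odd[of "u + v"]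
      odd[of u] odd[of v] by simp
  moreover have "q (c *\<^sub>R u) = c *\<^sub>R q u" for c u
  proof -
    consider "0 < c" | "c = 0" | "0 < - c" by linarith
    then show ?thesis
    proof cases
      case 3
      then show ?thesis
        using sublinear_scale[OF q, of "- c" u] odd[of "c *\<^sub>R u"] by simp
    qed (use sublinear_scale[OF q] sublinear_zero[OF q] in auto)
  qed
  ultimately show ?thesis by (rule linearI)
qed

text \<open>
  Only subadditivity needs the chain condition: two members of the chain that nearly attain the
  infimum at \<open>u\<close> and at \<open>v\<close> can be replaced by the smaller of the two.
\<close>
lemma sublinear_INF_chain:
  assumes C: "C \<noteq> {}" "\<And>q. q \<in> C \<Longrightarrow> sublinear q"
    and chain: "\<And>q r. q \<in> C \<Longrightarrow> r \<in> C \<Longrightarrow> (\<forall>u. q u \<le> r u) \<or> (\<forall>u. r u \<le> q u)"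
    and p: "\<And>q u. q \<in> C \<Longrightarrow> q u \<le> p u"
  shows "sublinear (\<lambda>u. INF q\<in>C. q u)" "\<And>q u. q \<in> C \<Longrightarrow> (INF q\<in>C. q u) \<le> q u"
proof -
  have "- p (- u) \<le> q u" if "q \<in> C" for q u
    using sublinear_minus[OF C(2)[OF that], of u] p[OF that, of "- u"] by simp
  then have bdd: "bdd_below ((\<lambda>q. q u) ` C)" for u
    by (intro bdd_belowI[where m = "- p (- u)"]) auto
  show lower: "(INF q\<in>C. q u) \<le> q u" if "q \<in> C" for q u
    by (rule cINF_lower[OF bdd that])
  have greatest: "c \<le> (INF q\<in>C. q u)" if "\<And>q. q \<in> C \<Longrightarrow> c \<le> q u" for c u
    by (rule cINF_greatest[OF C(1) that])
  have add: "(INF q\<in>C. q (u + v)) \<le> (INF q\<in>C. q u) + (INF q\<in>C. q v)" for u v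
  proof -
    have "(INF q\<in>C. q (u + v)) \<le> q u + r v" if qr: "q \<in> C" "r \<in> C" for q r
      using chain[OF qr]
    proof
      assume "\<forall>u. q u \<le> r u"
      then show ?thesis
        using lower[OF qr(1), of "u + v"] sublinear_add[OF C(2)[OF qr(1)], of u v]
        by (smt (verit))
    next
      assume "\<forall>u. r u \<le> q u"
      then show ?thesis
        using lower[OF qr(2), of "u + v"] sublinear_add[OF C(2)[OF qr(2)], of u v]
        by (smt (verit))
    qed
    then have "(INF q\<in>C. q (u + v)) - q u \<le> (INF q\<in>C. q v)" if "q \<in> C" for q
      using that by (intro greatest) (simp add: diff_le_eq add.commute[of _ "q u"])
    then have "(INF q\<in>C. q (u + v)) - (INF q\<in>C. q v) \<le> (INF q\<in>C. q u)"
      by (intro greatest) (simp add: algebra_simps)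
    then show ?thesis by simp
  qed
  have "(INF q\<in>C. q (c *\<^sub>R u)) \<le> c * (INF q\<in>C. q u)" if c: "0 < c" for c u
  proof -
    have "(INF q\<in>C. q (c *\<^sub>R u)) / c \<le> q u" if "q \<in> C" for q
      using lower[OF that, of "c *\<^sub>R u"] sublinear_scale[OF C(2)[OF that] c, of u] c
      by (simp add: field_simps)
    then have "(INF q\<in>C. q (c *\<^sub>R u)) / c \<le> (INF q\<in>C. q u)" by (rule greatest)
    then show ?thesis using c by (simp add: field_simps)
  qed
  with add show "sublinear (\<lambda>u. INF q\<in>C. q u)" by (simp add: sublinear_def)
qed

lemma sublinear_ex_minimal:
  fixes p :: "'v::real_vector \<Rightarrow> real"
  assumes p: "sublinear p"
  obtains q where "sublinear q" "\<And>u. q u \<le> p u"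
    "\<And>r. sublinear r \<Longrightarrow> (\<And>u. r u \<le> q u) \<Longrightarrow> r = q"
proof -
  define A where "A = {q. sublinear q \<and> (\<forall>u. q u \<le> p u)}"
  define R where "R q r \<longleftrightarrow> (\<forall>u. r u \<le> q u)" for q r :: "'v \<Rightarrow> real"
  have "\<exists>m\<in>A. \<forall>a\<in>A. R m a \<longrightarrow> a = m"
  proof (rule predicate_Zorn)
    show "partial_order_on A (relation_of R A)"
      by (rule partial_order_on_relation_ofI)
        (auto simp: R_def fun_eq_iff intro: order_trans antisym)
  next
    fix C assume C: "C \<in> Chains (relation_of R A)"
    have CA: "q \<in> A" if "q \<in> C" for q
      using C that unfolding Chains_def relation_of_def by auto
    show "\<exists>u\<in>A. \<forall>a\<in>C. R a u"
    proof (cases "C = {}")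
      case True
      with p show ?thesis by (auto simp: A_def)
    next
      case False
      have chain: "(\<forall>u. q u \<le> r u) \<or> (\<forall>u. r u \<le> q u)" if "q \<in> C" "r \<in> C" for q r
        using C that unfolding Chains_def relation_of_def R_def by auto
      have sub: "sublinear q" "q u \<le> p u" if "q \<in> C" for q u
        using CA[OF that] by (simp_all add: A_def)
      define q where "q = (\<lambda>u. INF q\<in>C. q u)"
      have "sublinear q"
        unfolding q_def
        by (rule sublinear_INF_chain(1)[where p = p]) (use False chain sub in blast)+
      moreover have "q u \<le> r u" if "r \<in> C" for r u
        unfolding q_def
        by (rule sublinear_INF_chain(2)[where p = p]) (use False chain sub that in blast)+
      then have "\<forall>r\<in>C. R r q" by (simp add: R_def)
      moreover have "q u \<le> p u" for u
        using False \<open>\<forall>r\<in>C. R r q\<close> sub(2) unfolding R_def by (meson all_not_in_conv order_trans)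
      ultimately show ?thesis unfolding A_def by auto
    qed
  qed
  then obtain q where q: "q \<in> A" "\<And>r. r \<in> A \<Longrightarrow> R q r \<Longrightarrow> r = q" by blast
  show ?thesis
  proof (rule that)
    show "sublinear q" "q u \<le> p u" for u using q(1) by (simp_all add: A_def)
    fix r assume r: "sublinear r" "\<And>u. r u \<le> q u"
    moreover have "r \<in> A"
      using r q(1) unfolding A_def by (auto intro: order_trans)
    ultimately show "r = q" using q(2) by (simp add: R_def)
  qed
qed

text \<open>
  One descent step at \<open>a\<close> before minimizing forces every linear functional below the lowered
  one to take the value \<open>p a\<close> at \<open>a\<close>.
\<close>
lemma hahn_banach_sublinear:
  assumes p: "sublinear p"
  obtains l where "linear l" "\<And>u. l u \<le> p u" "l a = p a"
proof -
  obtain r where r: "sublinear r" "\<And>u. r u \<le> p u" "r (- a) \<le> - p a"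
    using sublinear_descent[OF p] by blast
  obtain l where l: "sublinear l" "\<And>u. l u \<le> r u"
    "\<And>s. sublinear s \<Longrightarrow> (\<And>u. s u \<le> l u) \<Longrightarrow> s = l"
    using sublinear_ex_minimal[OF r(1)] by blast
  have "linear l" by (rule sublinear_minimal_linear) (use l in blast)+
  moreover have le: "l u \<le> p u" for u using l(2) r(2) order_trans by blast
  moreover have "- l a \<le> - p a"
    using l(2)[of "- a"] r(3) linear_neg[OF \<open>linear l\<close>, of a] by simp
  with le[of a] have "l a = p a" by simp
  ultimately show ?thesis by (rule that)
qed

text \<open>
  The distance to a convex cone is a sublinear functional that vanishes on the cone and is bounded
  by the norm. A linear minorant with the same value at \<open>a\<close> is therefore continuous and separates.
\<close>
lemma separate_point_cone:
  fixes K :: "'v::real_normed_vector set"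
  assumes K0: "0 \<in> K" and Kadd: "\<And>u v. u \<in> K \<Longrightarrow> v \<in> K \<Longrightarrow> u + v \<in> K"
    and Kscale: "\<And>c u. 0 < c \<Longrightarrow> u \<in> K \<Longrightarrow> c *\<^sub>R u \<in> K"
    and a: "a \<notin> closure K"
  obtains l where "bounded_linear l" "0 < l a" "\<And>u. u \<in> K \<Longrightarrow> l u \<le> (0::real)"
proof -
  have ne: "K \<noteq> {}" using K0 by auto
  define p where "p u = infdist u K" for u
  have "p (u + v) \<le> p u + p v" for u v
  proof -
    have "p (u + v) \<le> dist u x + dist v y" if "x \<in> K" "y \<in> K" for x y
      using infdist_le[OF Kadd[OF that], of "u + v"] dist_triangle_add[of u v x y]
      unfolding p_def by (rule order_trans)
    then have "p (u + v) - dist u x \<le> p v" if "x \<in> K" for x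
      unfolding p_def[of v] infdist_notempty[OF ne]
      using that by (intro cINF_greatest[OF ne]) (simp add: algebra_simps)
    then have "p (u + v) - p v \<le> p u"
      unfolding p_def[of u] infdist_notempty[OF ne]
      by (intro cINF_greatest[OF ne]) (simp add: algebra_simps)
    then show ?thesis by simp
  qed
  moreover have "p (c *\<^sub>R u) \<le> c * p u" if c: "0 < c" for c u
  proof -
    have "p (c *\<^sub>R u) / c \<le> dist u x" if "x \<in> K" for x
    proof -
      have "dist (c *\<^sub>R u) (c *\<^sub>R x) = c * dist u x"
        using c by (simp add: dist_norm flip: scaleR_diff_right)
      then show ?thesis
        using infdist_le[OF Kscale[OF c that], of "c *\<^sub>R u"] c
        by (simp add: p_def field_simps)
    qed
    then have "p (c *\<^sub>R u) / c \<le> p u"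
      unfolding p_def[of u] infdist_notempty[OF ne] by (intro cINF_greatest[OF ne])
    then show ?thesis using c by (simp add: field_simps)
  qed
  ultimately have "sublinear p" by (simp add: sublinear_def)
  then obtain l where l: "linear l" "\<And>u. l u \<le> p u" "l a = p a"
    using hahn_banach_sublinear by blast
  have bound: "l u \<le> norm u" for u
    using l(2)[of u] infdist_le[OF K0, of u] by (simp add: p_def)
  show ?thesis
  proof (rule that)
    show "bounded_linear l"
    proof (rule bounded_linear_intro[where K = 1])
      show "norm (l u) \<le> norm u * 1" for u
        using bound[of u] bound[of "- u"] linear_neg[OF l(1), of u] by simp
    qed (simp_all add: linear_add[OF l(1)] linear_scale[OF l(1)])
    show "0 < l a"
      using a in_closure_iff_infdist_zero[OF ne, of a] infdist_nonneg[of a K] l(3)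
      by (simp add: p_def order_less_le)
    show "l u \<le> 0" if "u \<in> K" for u
      using l(2)[of u] that by (simp add: p_def)
  qed
qed

section \<open>The negative part as distance to the positive cone\<close>

text \<open>
  The norm of \<open>neg_part x\<close> behaves like the distance of \<open>x\<close> to the positive cone: it is the
  least norm of a \<open>y \<ge> 0\<close> with \<open>0 \<le> x + y\<close> (lemma \<open>norm_neg_part_le\<close>), it is subadditive,
  and it is nonexpansive. All approximate inequalities are expressed in this form.
\<close>
lemma neg_part_nonneg: "0 \<le> neg_part x"
  by (simp add: neg_part_def)

lemma add_neg_part_nonneg: "0 \<le> x + neg_part x"
proof -
  have "- x \<le> neg_part x" by (simp add: neg_part_def)
  then have "x + - x \<le> x + neg_part x" by (rule add_left_mono)
  then show ?thesis by simp
qed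

lemma neg_part_of_nonneg: "0 \<le> x \<Longrightarrow> neg_part x = 0"
  by (simp add: neg_part_def sup_absorb2)

lemma pprt_eq_add_neg_part: "pprt x = x + neg_part x" for x :: "'a::banach_lattice"
  by (simp add: pprt_def neg_part_def add_sup_distrib_left sup.commute)

lemma norm_neg_part_le:
  assumes "0 \<le> y" "0 \<le> x + y" shows "norm (neg_part x) \<le> norm y"
proof (rule bl_norm_mono[OF neg_part_nonneg])
  have "- x \<le> y" using assms(2) by (metis minus_le_iff neg_le_iff_le add.commute diff_ge_0_iff_ge diff_minus_eq_add)
  then show "neg_part x \<le> y" using assms(1) by (simp add: neg_part_def)
qed

lemma norm_modulus: "norm (sup x (- x)) = norm x" for x :: "'a::banach_lattice"
proof -
  have "- sup x (- x) \<le> sup x (- x)"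
    using bl_modulus_nonneg[of x] by (meson neg_le_0_iff_le order_trans)
  then have "sup (sup x (- x)) (- sup x (- x)) = sup x (- x)" by (rule sup_absorb1)
  then show ?thesis by (intro antisym norm_le_of_modulus_le) simp_all
qed

lemma norm_neg_part_le_norm: "norm (neg_part x) \<le> norm x"
proof -
  have "x + - x \<le> x + sup x (- x)" by (intro add_left_mono) simp
  then show ?thesis
    using norm_neg_part_le[OF bl_modulus_nonneg[of x], of x] by (simp add: norm_modulus)
qed

lemma norm_neg_part_add:
  "norm (neg_part (x + y)) \<le> norm (neg_part x) + norm (neg_part y)"
proof -
  have "0 \<le> (x + neg_part x) + (y + neg_part y)"
    by (intro add_nonneg_nonneg add_neg_part_nonneg)
  then have "0 \<le> x + y + (neg_part x + neg_part y)" by (simp add: ac_simps)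
  moreover have "0 \<le> neg_part x + neg_part y" by (simp add: neg_part_nonneg)
  ultimately have "norm (neg_part (x + y)) \<le> norm (neg_part x + neg_part y)"
    by (intro norm_neg_part_le)
  also have "\<dots> \<le> norm (neg_part x) + norm (neg_part y)" by (rule norm_triangle_ineq)
  finally show ?thesis .
qed

lemma nonneg_if_norm_neg_part_zero: "norm (neg_part x) = 0 \<Longrightarrow> 0 \<le> x"
  using add_neg_part_nonneg[of x] by simp

lemma tendsto_norm_neg_part:
  fixes f :: "'b \<Rightarrow> 'a::banach_lattice"
  assumes "(f \<longlongrightarrow> l) F"
  shows "((\<lambda>t. norm (neg_part (f t))) \<longlongrightarrow> norm (neg_part l)) F"
proof (rule Lim_transform[OF tendsto_const])
  have *: "norm (neg_part a) \<le> norm (neg_part b) + norm (a - b)" for a b :: 'a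
    using norm_neg_part_add[of b "a - b"] norm_neg_part_le_norm[of "a - b"] by simp
  show "((\<lambda>t. norm (neg_part (f t)) - norm (neg_part l)) \<longlongrightarrow> 0) F"
  proof (rule Lim_null_comparison)
    show "\<forall>\<^sub>F t in F. norm (norm (neg_part (f t)) - norm (neg_part l)) \<le> norm (f t - l)"
      using *[of "f _" l] *[of l "f _"]
      by (intro always_eventually allI) (simp add: abs_le_iff norm_minus_commute algebra_simps)
    show "((\<lambda>t. norm (f t - l)) \<longlongrightarrow> 0) F"
      using assms by (simp add: tendsto_norm_zero_iff LIM_zero)
  qed
qed

lemma tendsto_nonneg:
  fixes f :: "'b \<Rightarrow> 'a::banach_lattice"
  assumes "(f \<longlongrightarrow> l) F" "F \<noteq> bot" "\<forall>\<^sub>F t in F. 0 \<le> f t"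
  shows "0 \<le> l"
proof (rule nonneg_if_norm_neg_part_zero, rule tendsto_unique)
  show "((\<lambda>t. norm (neg_part (f t))) \<longlongrightarrow> norm (neg_part l)) F"
    by (rule tendsto_norm_neg_part) fact
  show "((\<lambda>t. norm (neg_part (f t))) \<longlongrightarrow> 0) F"
    by (rule tendsto_eventually)
      (use assms(3) in \<open>auto elim: eventually_mono simp: neg_part_of_nonneg\<close>)
qed fact

lemma tendsto_le_vector:
  fixes f g :: "'b \<Rightarrow> 'a::banach_lattice"
  assumes "(f \<longlongrightarrow> l) F" "(g \<longlongrightarrow> m) F" "F \<noteq> bot" "\<forall>\<^sub>F t in F. f t \<le> g t"
  shows "l \<le> m"
  using tendsto_nonneg[OF tendsto_diff[OF assms(2,1)] assms(3)] assms(4) by simp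

section \<open>Operators whose adjoint is a lattice homomorphism\<close>
definition positive_operator :: "('a::banach_lattice \<Rightarrow>\<^sub>L 'a) \<Rightarrow> bool"
  where "positive_operator T \<longleftrightarrow> (\<forall>x\<ge>0. 0 \<le> T x)"

lemma positive_operator_mono: "positive_operator T \<Longrightarrow> x \<le> y \<Longrightarrow> T x \<le> T y"
  unfolding positive_operator_def
  by (metis blinfun.diff_right diff_ge_0_iff_ge)

lemma norm_neg_part_positive_operator:
  assumes "positive_operator T"
  shows "norm (neg_part (T x)) \<le> norm T * norm (neg_part x)"
proof -
  have "0 \<le> T (x + neg_part x)" "0 \<le> T (neg_part x)"
    using assms add_neg_part_nonneg neg_part_nonneg unfolding positive_operator_def by blast+
  then have "norm (neg_part (T x)) \<le> norm (T (neg_part x))"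
    by (intro norm_neg_part_le) (simp_all add: blinfun.add_right)
  also have "\<dots> \<le> norm T * norm (neg_part x)" by (rule norm_blinfun)
  finally show ?thesis .
qed

lemma pprt_positive_operator_le:
  assumes "positive_operator T" shows "pprt (T x) \<le> T (pprt x)"
proof -
  have "x \<le> pprt x" by (simp add: pprt_def)
  then have "T x \<le> T (pprt x)" by (rule positive_operator_mono[OF assms])
  moreover have "0 \<le> T (pprt x)" using assms by (simp add: positive_operator_def)
  ultimately show ?thesis by (simp add: pprt_def)
qed

definition almost_interval_preserving :: "('a::banach_lattice \<Rightarrow>\<^sub>L 'a) \<Rightarrow> bool"
  where "almost_interval_preserving T \<longleftrightarrow>
    (\<forall>x z. 0 \<le> x \<longrightarrow> 0 \<le> z \<longrightarrow> z \<le> T x \<longrightarrow>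
      (\<forall>e>0. \<exists>y. 0 \<le> y \<and> y \<le> x \<and> norm (T y - z) < e))"

text \<open>
  A functional on the product space that separates \<open>(z, - x)\<close> from this cone is a pair of
  functionals \<open>\<phi>\<close> and \<open>\<rho>\<close> such that \<open>\<rho>\<close> dominates both \<open>0\<close> and the adjoint image of \<open>\<phi>\<close>,
  but \<open>\<rho> x < \<phi> z\<close>. The adjoint preserves the supremum of \<open>\<phi>\<close> and \<open>0\<close>, so \<open>\<rho>\<close> dominates its image
  as well, and this contradicts \<open>z \<le> T x\<close>. Separating in the product avoids any formula for the
  values of the supremum of two functionals.
\<close>
lemma in_closure_image_cone:
  fixes T :: "'a::banach_lattice \<Rightarrow>\<^sub>L 'a"
  assumes hom: "dual_lattice_hom (dual_operator T)" and "0 \<le> x" "0 \<le> z" "z \<le> T x"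
  shows "(z, - x) \<in> closure {(T y, - (y + w)) | y w. 0 \<le> y \<and> 0 \<le> w}" (is "_ \<in> closure ?K")
proof (rule ccontr)
  assume not_in: "(z, - x) \<notin> closure ?K"
  have mem: "(T y, - (y + w)) \<in> ?K" if "0 \<le> y" "0 \<le> w" for y w using that by blast
  obtain l :: "'a \<times> 'a \<Rightarrow> real" where l: "bounded_linear l" "0 < l (z, - x)"
    "\<And>u. u \<in> ?K \<Longrightarrow> l u \<le> 0"
  proof (rule separate_point_cone[OF _ _ _ not_in])
    show "0 \<in> ?K" using mem[of 0 0] by (simp add: zero_prod_def)
    show "u + v \<in> ?K" if "u \<in> ?K" "v \<in> ?K" for u v
    proof -
      from that obtain y w y' w' where
        uv: "u = (T y, - (y + w))" "v = (T y', - (y' + w'))"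
        and nonneg: "0 \<le> y" "0 \<le> w" "0 \<le> y'" "0 \<le> w'"
        by blast
      have "u + v = (T (y + y'), - ((y + y') + (w + w')))"
        by (simp add: uv blinfun.add_right ac_simps)
      also have "\<dots> \<in> ?K" by (rule mem) (use nonneg in simp_all)
      finally show ?thesis .
    qed
    show "c *\<^sub>R u \<in> ?K" if "0 < c" "u \<in> ?K" for c u
    proof -
      from that obtain y w where "u = (T y, - (y + w))" "0 \<le> y" "0 \<le> w" by blast
      then show ?thesis
        using mem[of "c *\<^sub>R y" "c *\<^sub>R w"] that(1)
        by (simp add: blinfun.scaleR_right scaleR_nonneg_nonneg algebra_simps)
    qed
  qed blast
  interpret l: bounded_linear l by fact
  define \<phi> where "\<phi> = Blinfun (\<lambda>u. l (u, 0))"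
  define \<rho> where "\<rho> = Blinfun (\<lambda>u. l (0, u))"
  have \<phi>: "\<phi> u = l (u, 0)" for u
    unfolding \<phi>_def
    by (rule bounded_linear_Blinfun_apply[THEN fun_cong])
      (intro bounded_linear_compose[OF l(1)] bounded_linear_Pair bounded_linear_ident bounded_linear_zero)
  have \<rho>: "\<rho> u = l (0, u)" for u
    unfolding \<rho>_def
    by (rule bounded_linear_Blinfun_apply[THEN fun_cong])
      (intro bounded_linear_compose[OF l(1)] bounded_linear_Pair bounded_linear_ident bounded_linear_zero)
  have split: "l (u, - v) = \<phi> u - \<rho> v" for u v
    using l.diff[of "(u, 0)" "(0, v)"] by (simp add: \<phi> \<rho>)
  define \<sigma> where "\<sigma> = dual_sup \<phi> 0"
  have \<sigma>: "dual_le \<phi> \<sigma>" "dual_le 0 \<sigma>"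
    using is_dual_sup_dual_sup[of \<phi> 0] by (simp_all add: \<sigma>_def is_dual_sup_def)
  have "dual_operator T \<sigma> = dual_sup (dual_operator T \<phi>) (dual_operator T 0)"
    using hom by (simp add: dual_lattice_hom_def \<sigma>_def)
  moreover have "dual_le (dual_operator T \<phi>) \<rho>" "dual_le (dual_operator T 0) \<rho>"
    using l(3)[OF mem[of _ 0]] l(3)[OF mem[of 0 _]]
    by (simp_all add: dual_le_def dual_operator_def split)
  ultimately have "dual_le (dual_operator T \<sigma>) \<rho>"
    using is_dual_sup_dual_sup[of "dual_operator T \<phi>" "dual_operator T 0"]
    by (simp add: is_dual_sup_def)
  then have "\<sigma> (T x) \<le> \<rho> x"
    using \<open>0 \<le> x\<close> by (simp add: dual_le_def dual_operator_def)
  moreover have "\<phi> z \<le> \<sigma> z" using \<sigma>(1) \<open>0 \<le> z\<close> by (simp add: dual_le_def)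
  moreover have "0 \<le> \<sigma> (T x - z)"
    using \<sigma>(2) \<open>z \<le> T x\<close> by (simp add: dual_le_def)
  then have "\<sigma> z \<le> \<sigma> (T x)" by (simp add: blinfun.diff_right)
  moreover have "\<rho> x < \<phi> z" using l(2) by (simp add: split)
  ultimately show False by simp
qed

text \<open>
  Approximating \<open>(z, - x)\<close> by \<open>(T y, - (y + w))\<close> means that \<open>T y\<close> is close to \<open>z\<close>, where
  \<open>y\<close> exceeds \<open>x\<close> by little; then \<open>inf y x\<close> lies in the interval and is close to \<open>y\<close>.
\<close>
lemma almost_interval_preserving_if_dual_lattice_hom:
  fixes T :: "'a::banach_lattice \<Rightarrow>\<^sub>L 'a"
  assumes "dual_lattice_hom (dual_operator T)"
  shows "almost_interval_preserving T"
  unfolding almost_interval_preserving_def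
proof (intro allI impI)
  fix x z :: 'a and e :: real
  assume xz: "0 \<le> x" "0 \<le> z" "z \<le> T x" and "0 < e"
  \<comment> \<open>The error \<open>d\<close> occurs once in \<open>T y\<close> and once under \<open>T\<close>, when \<open>y\<close> is cut off at \<open>x\<close>.\<close>
  define d where "d = e / (1 + norm T)"
  have d: "0 < d" "d + norm T * d = e"
    using \<open>0 < e\<close> by (simp_all add: d_def field_simps add_pos_nonneg add_nonneg_eq_0_iff)
  from in_closure_image_cone[OF assms xz] d(1) obtain y w where
    yw: "0 \<le> y" "0 \<le> w" "dist (T y, - (y + w)) (z, - x) < d"
    unfolding closure_approachable by blast
  have Ty: "norm (T y - z) < d"
    using yw(3) dist_fst_le[of "(T y, - (y + w))" "(z, - x)"] by (simp add: dist_norm)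
  have r: "norm (x - y - w) < d"
    using yw(3) dist_snd_le[of "(T y, - (y + w))" "(z, - x)"]
    by (simp add: dist_norm algebra_simps)
  define y' where "y' = y - neg_part (x - y)"
  have y': "y' = inf y x"
  proof -
    have "y - sup (y - x) 0 = y + inf (x - y) 0"
      by (metis diff_conv_add_uminus minus_diff_eq neg_sup_eq_inf neg_0_equal_iff_equal minus_zero)
    also have "\<dots> = inf x y" by (simp add: add_inf_distrib_left)
    finally show ?thesis unfolding y'_def neg_part_def by (simp add: inf.commute)
  qed
  have "norm (neg_part (x - y)) \<le> norm (neg_part w) + norm (neg_part (x - y - w))"
    using norm_neg_part_add[of w "x - y - w"] by simp
  also have "\<dots> < d"
    using r norm_neg_part_le_norm[of "x - y - w"] yw(2) by (simp add: neg_part_of_nonneg)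
  finally have "norm T * norm (neg_part (x - y)) \<le> norm T * d"
    by (intro mult_left_mono) simp_all
  then have "norm (T (neg_part (x - y))) \<le> norm T * d"
    using norm_blinfun[of T "neg_part (x - y)"] by simp
  then have "norm (T y' - z) < e"
    using norm_triangle_ineq4[of "T y - z" "T (neg_part (x - y))"] Ty d(2)
    by (simp add: y'_def blinfun.diff_right algebra_simps)
  moreover have "0 \<le> y'" "y' \<le> x" using xz yw by (simp_all add: y')
  ultimately show "\<exists>y. 0 \<le> y \<and> y \<le> x \<and> norm (T y - z) < e" by blast
qed

section \<open>Monotone convergence and exact interval preservation in AL-spaces\<close>
lemma norm_diff_of_le:
  fixes x y :: "'a::al_space"
  assumes "0 \<le> x" "x \<le> y" shows "norm (y - x) = norm y - norm x"
  using norm_add_of_nonneg[of x "y - x"] assms by simp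

text \<open>
  On chains of nonnegative vectors the norm is an isometry into the reals.
\<close>
lemma convergent_of_chain:
  fixes u :: "nat \<Rightarrow> 'a::al_space"
  assumes nonneg: "\<And>n. 0 \<le> u n" and chain: "\<And>m n. m \<le> n \<Longrightarrow> u m \<le> u n \<or> u n \<le> u m"
    and conv: "convergent (\<lambda>n. norm (u n))"
  shows "convergent u"
proof -
  have "dist (u m) (u n) = dist (norm (u m)) (norm (u n))" if "m \<le> n" for m n
    using chain[OF that] norm_diff_of_le[OF nonneg] bl_norm_mono[OF nonneg]
    by (metis abs_of_nonneg diff_ge_0_iff_ge dist_commute dist_norm real_norm_def)
  then have "dist (u m) (u n) = dist (norm (u m)) (norm (u n))" for m n
    by (metis dist_commute nle_le)
  with conv show ?thesis
    by (simp add: Cauchy_convergent_iff[symmetric] Cauchy_def)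
qed

lemma decseq_nonneg_convergent:
  fixes u :: "nat \<Rightarrow> 'a::al_space"
  assumes "\<And>n. 0 \<le> u n" "\<And>n. u (Suc n) \<le> u n"
  obtains l where "u \<longlonglongrightarrow> l" "0 \<le> l" "\<And>n. l \<le> u n"
proof -
  have dec: "u n \<le> u m" if "m \<le> n" for m n
    using that assms(2) by (rule lift_Suc_antimono_le[rotated])
  then have "decseq (\<lambda>n. norm (u n))"
    by (auto simp: decseq_def intro: bl_norm_mono assms(1))
  then have "convergent (\<lambda>n. norm (u n))"
    by (rule decseq_convergent[of _ 0]) (auto simp: convergent_def)
  then have "convergent u" using assms(1) dec by (intro convergent_of_chain) auto
  then obtain l where l: "u \<longlonglongrightarrow> l" by (auto simp: convergent_def)
  show ?thesis
  proof (rule that[OF l])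
    show "0 \<le> l" by (rule tendsto_nonneg[OF l]) (simp_all add: assms(1))
    show "l \<le> u n" for n
      by (rule tendsto_le_vector[OF l tendsto_const[of "u n"]])
        (auto simp: eventually_sequentially intro: dec)
  qed
qed

lemma incseq_bounded_convergent:
  fixes u :: "nat \<Rightarrow> 'a::al_space"
  assumes "\<And>n. 0 \<le> u n" "\<And>n. u n \<le> u (Suc n)" "\<And>n. norm (u n) \<le> B"
  obtains l where "u \<longlonglongrightarrow> l" "\<And>n. u n \<le> l"
proof -
  have inc: "u m \<le> u n" if "m \<le> n" for m n
    using that assms(2) by (rule lift_Suc_mono_le[rotated])
  then have "incseq (\<lambda>n. norm (u n))"
    by (auto simp: incseq_def intro: bl_norm_mono assms(1))
  then have "convergent (\<lambda>n. norm (u n))"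
    by (rule incseq_convergent[of _ B]) (auto simp: convergent_def assms(3))
  then have "convergent u" using assms(1) inc by (intro convergent_of_chain) auto
  then obtain l where l: "u \<longlonglongrightarrow> l" by (auto simp: convergent_def)
  show ?thesis
  proof (rule that[OF l])
    show "u n \<le> l" for n
      by (rule tendsto_le_vector[OF tendsto_const[of "u n"] l])
        (auto simp: eventually_sequentially intro: inc)
  qed
qed

text \<open>
  Construct \<open>x \<ge> v\<^sub>0 \<ge> v\<^sub>1 \<ge> \<dots>\<close> by approximating, in step \<open>n + 1\<close>, the vector
  \<open>inf z (T v\<^sub>n)\<close> by the image of some \<open>v\<^sub>n\<^sub>+\<^sub>1 \<le> v\<^sub>n\<close>. The excess of the image of \<open>v\<^sub>n\<close> over \<open>z\<close>
  comes from the last step only and so tends to zero, whereas the deficits add up to at most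
  \<open>e\<close>. Hence the image of the limit lies below \<open>z\<close>, with error at most \<open>e\<close>.
\<close>
lemma almost_interval_preserving_from_below:
  fixes T :: "'a::al_space \<Rightarrow>\<^sub>L 'a"
  assumes pos: "positive_operator T" and dense: "almost_interval_preserving T"
    and "0 \<le> x" "0 \<le> z" "z \<le> T x" "0 < e"
  obtains v where "0 \<le> v" "v \<le> x" "T v \<le> z" "norm (z - T v) \<le> e"
proof -
  define \<delta> where "\<delta> n = e * (1/2) ^ Suc n" for n
  have \<delta>: "0 < \<delta> n" for n using \<open>0 < e\<close> by (simp add: \<delta>_def)
  have approx: "\<exists>y. 0 \<le> y \<and> y \<le> w \<and> norm (T y - z') < \<delta> n"
    if "0 \<le> w" "0 \<le> z'" "z' \<le> T w" for w z' n
    using dense that \<delta> unfolding almost_interval_preserving_def by blast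
  have "\<exists>v. \<forall>n. (0 \<le> v n \<and> v n \<le> x \<and> norm (neg_part (z - T (v n))) \<le> \<delta> n
        \<and> norm (neg_part (T (v n) - z)) \<le> (\<Sum>i\<le>n. \<delta> i)) \<and> v (Suc n) \<le> v n"
  proof (rule dependent_nat_choice)
    obtain y where "0 \<le> y" "y \<le> x" "norm (T y - z) < \<delta> 0"
      using approx assms by blast
    then show "\<exists>v. 0 \<le> v \<and> v \<le> x \<and> norm (neg_part (z - T v)) \<le> \<delta> 0
        \<and> norm (neg_part (T v - z)) \<le> (\<Sum>i\<le>0. \<delta> i)"
      using norm_neg_part_le_norm[of "z - T y"] norm_neg_part_le_norm[of "T y - z"]
      by (intro exI[of _ y]) (auto simp: norm_minus_commute)
  next
    fix v n
    assume v: "0 \<le> v \<and> v \<le> x \<and> norm (neg_part (z - T v)) \<le> \<delta> n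
        \<and> norm (neg_part (T v - z)) \<le> (\<Sum>i\<le>n. \<delta> i)"
    define z' where "z' = inf z (T v)"
    have "0 \<le> T v" using v pos by (simp add: positive_operator_def)
    then obtain y where y: "0 \<le> y" "y \<le> v" "norm (T y - z') < \<delta> (Suc n)"
      using approx[of v z' "Suc n"] v \<open>0 \<le> z\<close> by (auto simp: z'_def)
    have "norm (neg_part (z - T y)) \<le> norm (neg_part (z - z')) + norm (neg_part (z' - T y))"
      using norm_neg_part_add[of "z - z'" "z' - T y"] by simp
    also have "\<dots> \<le> \<delta> (Suc n)"
      using y(3) norm_neg_part_le_norm[of "z' - T y"] neg_part_of_nonneg[of "z - z'"]
      by (simp only: z'_def diff_ge_0_iff_ge inf_le1 norm_zero norm_minus_commute[of "T y"])
    finally have 1: "norm (neg_part (z - T y)) \<le> \<delta> (Suc n)" .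
    have "z \<le> z + neg_part (T v - z)" "z \<le> T v + neg_part (T v - z)"
      using neg_part_nonneg[of "T v - z"] add_neg_part_nonneg[of "T v - z"]
      by (simp_all add: algebra_simps)
    then have "z \<le> z' + neg_part (T v - z)"
      by (simp add: z'_def add_inf_distrib_right)
    then have "norm (neg_part (z' - z)) \<le> norm (neg_part (T v - z))"
      by (intro norm_neg_part_le neg_part_nonneg) (simp add: algebra_simps)
    with v have "norm (neg_part (z' - z)) \<le> (\<Sum>i\<le>n. \<delta> i)" by simp
    then have 2: "norm (neg_part (T y - z)) \<le> (\<Sum>i\<le>Suc n. \<delta> i)"
      using norm_neg_part_add[of "T y - z'" "z' - z"] norm_neg_part_le_norm[of "T y - z'"] y(3)
      by simp
    show "\<exists>y. (0 \<le> y \<and> y \<le> x \<and> norm (neg_part (z - T y)) \<le> \<delta> (Suc n)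
        \<and> norm (neg_part (T y - z)) \<le> (\<Sum>i\<le>Suc n. \<delta> i)) \<and> y \<le> v"
      using y 1 2 v order_trans by blast
  qed
  then obtain v where v: "\<And>n. 0 \<le> v n" "\<And>n. v n \<le> x" "\<And>n. v (Suc n) \<le> v n"
    "\<And>n. norm (neg_part (z - T (v n))) \<le> \<delta> n"
    "\<And>n. norm (neg_part (T (v n) - z)) \<le> (\<Sum>i\<le>n. \<delta> i)"
    by blast
  obtain l where l: "v \<longlonglongrightarrow> l" "0 \<le> l" "\<And>n. l \<le> v n"
    using decseq_nonneg_convergent[of v] v(1,3) by blast
  have Tv: "(\<lambda>n. T (v n)) \<longlonglongrightarrow> T l" by (intro blinfun.tendsto tendsto_const l(1))
  have "norm (neg_part (z - T l)) \<le> 0"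
  proof (rule LIMSEQ_le)
    show "(\<lambda>n. norm (neg_part (z - T (v n)))) \<longlonglongrightarrow> norm (neg_part (z - T l))"
      by (intro tendsto_norm_neg_part tendsto_diff tendsto_const Tv)
    have "(\<lambda>n. e * (1/2::real) ^ Suc n) \<longlonglongrightarrow> e * 0"
      by (intro tendsto_mult tendsto_const LIMSEQ_Suc LIMSEQ_power_zero) simp
    then show "\<delta> \<longlonglongrightarrow> 0" by (simp add: \<delta>_def[abs_def])
  qed (use v(4) in blast)
  then have le: "T l \<le> z" using nonneg_if_norm_neg_part_zero[of "z - T l"] by simp
  have sum: "(\<Sum>i\<le>n. \<delta> i) = e * (1 - (1/2) ^ Suc n)" for n
    by (induction n) (simp_all add: \<delta>_def algebra_simps)
  have "norm (neg_part (T l - z)) \<le> e"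
  proof (rule LIMSEQ_le_const2)
    show "(\<lambda>n. norm (neg_part (T (v n) - z))) \<longlonglongrightarrow> norm (neg_part (T l - z))"
      by (intro tendsto_norm_neg_part tendsto_diff tendsto_const Tv)
    have "norm (neg_part (T (v n) - z)) \<le> e" for n
    proof -
      have "(\<Sum>i\<le>n. \<delta> i) \<le> e"
        unfolding sum using \<open>0 < e\<close> by (simp add: mult_le_cancel_left1)
      with v(5)[of n] show ?thesis by simp
    qed
    then show "\<exists>N. \<forall>n\<ge>N. norm (neg_part (T (v n) - z)) \<le> e" by blast
  qed
  moreover have "neg_part (T l - z) = z - T l"
    using le by (simp add: neg_part_def sup_absorb1)
  ultimately have "norm (z - T l) \<le> e" by simp
  with l(2) le l(3)[of 0] v(2)[of 0] show ?thesis
    by (intro that[of l]) auto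
qed

text \<open>
  Applying the approximation from below to the remainder \<open>z - T u\<close> in the interval below
  \<open>T (x - u)\<close> increases \<open>u\<close>, so that the approximations form an increasing sequence below \<open>x\<close>.
\<close>
lemma interval_preserving:
  fixes T :: "'a::al_space \<Rightarrow>\<^sub>L 'a"
  assumes pos: "positive_operator T" and dense: "almost_interval_preserving T"
    and x: "0 \<le> x" and z: "0 \<le> z" "z \<le> T x"
  obtains y where "0 \<le> y" "y \<le> x" "T y = z"
proof -
  define \<delta> :: "nat \<Rightarrow> real" where "\<delta> n = inverse (real (Suc n))" for n
  have \<delta>: "0 < \<delta> n" for n by (simp add: \<delta>_def)
  have "\<exists>u. \<forall>n. (0 \<le> u n \<and> u n \<le> x \<and> T (u n) \<le> z \<and> norm (z - T (u n)) \<le> \<delta> n)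
      \<and> u n \<le> u (Suc n)"
  proof (rule dependent_nat_choice)
    show "\<exists>u. 0 \<le> u \<and> u \<le> x \<and> T u \<le> z \<and> norm (z - T u) \<le> \<delta> 0"
      using almost_interval_preserving_from_below[OF pos dense x z \<delta>] by metis
  next
    fix u n
    assume u: "0 \<le> u \<and> u \<le> x \<and> T u \<le> z \<and> norm (z - T u) \<le> \<delta> n"
    have "0 \<le> x - u" "0 \<le> z - T u" "z - T u \<le> T (x - u)"
      using u z by (simp_all add: blinfun.diff_right)
    then obtain v where v: "0 \<le> v" "v \<le> x - u" "T v \<le> z - T u"
      "norm (z - T u - T v) \<le> \<delta> (Suc n)"
      by (rule almost_interval_preserving_from_below[OF pos dense _ _ _ \<delta>])
    show "\<exists>u'. (0 \<le> u' \<and> u' \<le> x \<and> T u' \<le> z \<and> norm (z - T u') \<le> \<delta> (Suc n)) \<and> u \<le> u'"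
      using u v
      by (intro exI[of _ "u + v"]) (auto simp: blinfun.add_right algebra_simps)
  qed
  then obtain u where u: "\<And>n. 0 \<le> u n" "\<And>n. u n \<le> x" "\<And>n. norm (z - T (u n)) \<le> \<delta> n"
    "\<And>n. u n \<le> u (Suc n)"
    by blast
  have "norm (u n) \<le> norm x" for n by (rule bl_norm_mono) (simp_all add: u)
  then obtain l where l: "u \<longlonglongrightarrow> l" "\<And>n. u n \<le> l"
    using incseq_bounded_convergent[of u] u(1,4) by blast
  have "(\<lambda>n. norm (z - T (u n))) \<longlonglongrightarrow> norm (z - T l)"
    by (intro tendsto_intros blinfun.tendsto l(1))
  moreover have "\<delta> \<longlonglongrightarrow> 0" unfolding \<delta>_def[abs_def] by (rule LIMSEQ_inverse_real_of_nat)
  ultimately have "norm (z - T l) \<le> 0" by (rule LIMSEQ_le) (use u(3) in blast)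
  then have "T l = z" by simp
  moreover have "0 \<le> l" using u(1) l(2) order_trans by blast
  moreover have "l \<le> x"
    by (rule tendsto_le_vector[OF l(1) tendsto_const[of x]]) (simp_all add: u(2))
  ultimately show ?thesis using that by blast
qed

section \<open>Bounded positive semigroups and their lower bounds\<close>
locale bounded_positive_semigroup =
  fixes J :: "real set" and T :: "real \<Rightarrow> 'a::al_space \<Rightarrow>\<^sub>L 'a" and M :: real
  assumes times: "J = real ` {1..} \<or> J = {0<..}"
    and semigroup: "\<And>s t. s \<in> J \<Longrightarrow> t \<in> J \<Longrightarrow> T (t + s) = T t o\<^sub>L T s"
    and norm_le: "\<And>t. t \<in> J \<Longrightarrow> norm (T t) \<le> M"
    and positive: "\<And>t. t \<in> J \<Longrightarrow> positive_operator (T t)"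
begin

abbreviation lower_bound :: "'a \<Rightarrow> 'a \<Rightarrow> bool"
  where "lower_bound \<equiv> is_lower_bound J T"

lemma apply_add: "s \<in> J \<Longrightarrow> t \<in> J \<Longrightarrow> T (t + s) f = T t (T s f)"
  by (simp add: semigroup)

lemma nat_in_times: "real (Suc n) \<in> J"
  using times by (auto simp del: of_nat_Suc)

lemma pos_times: "t \<in> J \<Longrightarrow> 0 < t"
  using times by auto

lemma add_times: "s \<in> J \<Longrightarrow> t \<in> J \<Longrightarrow> s + t \<in> J"
  using times
  by (auto simp flip: of_nat_add)

lemma diff_times: "s \<in> J \<Longrightarrow> t \<in> J \<Longrightarrow> s < t \<Longrightarrow> t - s \<in> J"
  using times
  by (auto simp flip: of_nat_diff)

lemma mult_times: "s \<in> J \<Longrightarrow> real (Suc n) * s \<in> J"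
proof (induction n)
  case (Suc n)
  then have "s + real (Suc n) * s \<in> J" using add_times by blast
  then show ?case by (simp add: algebra_simps)
qed simp

lemma norm_apply_le: "t \<in> J \<Longrightarrow> norm (T t f) \<le> M * norm f"
  using norm_blinfun[of "T t" f] mult_right_mono[OF norm_le[of t] norm_ge_zero[of f]] by simp

lemma apply_nonneg: "t \<in> J \<Longrightarrow> 0 \<le> f \<Longrightarrow> 0 \<le> T t f"
  using positive by (simp add: positive_operator_def)

lemma apply_mono: "t \<in> J \<Longrightarrow> f \<le> g \<Longrightarrow> T t f \<le> T t g"
  by (rule positive_operator_mono[OF positive])

lemma eventually_at_top_in:
  "eventually P (at_top_in J) \<longleftrightarrow> (\<exists>t0. \<forall>t\<in>J. t0 \<le> t \<longrightarrow> P t)"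
  by (auto simp: eventually_inf_principal eventually_at_top_linorder)

lemma eventually_in_times: "\<forall>\<^sub>F t in at_top_in J. t \<in> J \<and> s < t"
  unfolding eventually_at_top_in by (intro exI[of _ "s + 1"]) auto

lemma filterlim_at_top_in:
  assumes "filterlim r at_top F" "\<forall>\<^sub>F x in F. r x \<in> J"
  shows "filterlim r (at_top_in J) F"
  using assms by (simp add: filterlim_inf filterlim_principal)

lemma filterlim_mult_times:
  "s \<in> J \<Longrightarrow> filterlim (\<lambda>n. real (Suc n) * s) (at_top_in J) sequentially"
proof (rule filterlim_at_top_in)
  assume s: "s \<in> J"
  then have "filterlim (\<lambda>n. s * real (Suc n)) at_top sequentially"
    by (intro filterlim_tendsto_pos_mult_at_top[OF tendsto_const] pos_times
        filterlim_compose[OF filterlim_real_sequentially filterlim_Suc])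
  then show "filterlim (\<lambda>n. real (Suc n) * s) at_top sequentially" by (simp only: mult.commute)
  show "\<forall>\<^sub>F n in sequentially. real (Suc n) * s \<in> J"
    using mult_times[OF s] by (intro always_eventually) blast
qed

lemma filterlim_nat_times: "filterlim (\<lambda>n. real (Suc n)) (at_top_in J) sequentially"
  using nat_in_times
  by (intro filterlim_at_top_in always_eventually allI
      filterlim_compose[OF filterlim_real_sequentially filterlim_Suc])

lemma at_top_in_neq_bot: "at_top_in J \<noteq> bot"
proof
  assume "at_top_in J = bot"
  then have "eventually (\<lambda>_. False) (at_top_in J)" by simp
  then obtain t0 where "\<forall>t\<in>J. \<not> t0 \<le> t" unfolding eventually_at_top_in by blast
  moreover obtain n where "t0 \<le> real n" using real_arch_simple by blast
  ultimately show False using nat_in_times[of n] by force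
qed

lemma filterlim_diff_times:
  assumes "s \<in> J" shows "filterlim (\<lambda>t. t - s) (at_top_in J) (at_top_in J)"
proof (rule filterlim_at_top_in)
  have "filterlim (\<lambda>t. - s + t) at_top (at_top_in J)"
    by (rule filterlim_tendsto_add_at_top[OF tendsto_const])
      (rule filterlim_mono[OF filterlim_ident order_refl inf_le1])
  then show "filterlim (\<lambda>t. t - s) at_top (at_top_in J)" by simp
  show "\<forall>\<^sub>F t in at_top_in J. t - s \<in> J"
    using eventually_in_times[of s] by (rule eventually_mono) (simp add: diff_times assms)
qed

lemma lower_bound_compare:
  assumes "0 \<le> h" "(e \<longlongrightarrow> 0) (at_top_in J)"
    and "\<And>t. t \<in> J \<Longrightarrow> s < t \<Longrightarrow> norm (neg_part (T t f - h)) \<le> e t"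
  shows "lower_bound f h"
  unfolding is_lower_bound_def
proof (intro conjI assms(1) Lim_null_comparison[OF _ assms(2)])
  show "\<forall>\<^sub>F t in at_top_in J. norm (norm (neg_part (T t f - h))) \<le> e t"
    using eventually_in_times[of s] by (rule eventually_mono) (simp add: assms(3))
qed

lemma lower_boundD:
  assumes "lower_bound f h"
  shows "0 \<le> h" "((\<lambda>t. norm (neg_part (T t f - h))) \<longlongrightarrow> 0) (at_top_in J)"
  using assms by (simp_all add: is_lower_bound_def)

lemma norm_lower_bound_le_apply:
  assumes "0 \<le> h"
  shows "norm h \<le> norm (T t f) + norm (neg_part (T t f - h))"
proof -
  have "h \<le> T t f + neg_part (T t f - h)"
    using add_neg_part_nonneg[of "T t f - h"] by (simp add: algebra_simps)
  then have "norm h \<le> norm (T t f + neg_part (T t f - h))" using assms by (intro bl_norm_mono)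
  also have "\<dots> \<le> norm (T t f) + norm (neg_part (T t f - h))" by (rule norm_triangle_ineq)
  finally show ?thesis .
qed

lemma norm_lower_bound_le:
  assumes "lower_bound f h" shows "norm h \<le> M * norm f"
proof (rule tendsto_lowerbound[OF _ _ at_top_in_neq_bot])
  show "((\<lambda>t. M * norm f + norm (neg_part (T t f - h))) \<longlongrightarrow> M * norm f) (at_top_in J)"
    using tendsto_add[OF tendsto_const lower_boundD(2)[OF assms], of "M * norm f"] by simp
  show "\<forall>\<^sub>F t in at_top_in J. norm h \<le> M * norm f + norm (neg_part (T t f - h))"
    using eventually_in_times[of 0]
  proof (rule eventually_mono)
    fix t assume "t \<in> J \<and> 0 < t"
    then show "norm h \<le> M * norm f + norm (neg_part (T t f - h))"
      using norm_lower_bound_le_apply[OF lower_boundD(1)[OF assms], of t f] norm_apply_le[of t f]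
      by simp
  qed
qed

lemma lower_bound_sup:
  assumes "lower_bound f h" "lower_bound f k" shows "lower_bound f (sup h k)"
proof (rule lower_bound_compare)
  show "0 \<le> sup h k" using lower_boundD(1)[OF assms(1)] by (rule le_supI1)
  let ?e = "\<lambda>h t. neg_part (T t f - h)"
  show "((\<lambda>t. norm (?e h t) + norm (?e k t)) \<longlongrightarrow> 0) (at_top_in J)"
    using tendsto_add[OF assms[THEN lower_boundD(2)]] by simp
  fix t
  have "h \<le> T t f + (?e h t + ?e k t)" "k \<le> T t f + (?e h t + ?e k t)"
    using add_mono[OF add_neg_part_nonneg[of "T t f - h"] neg_part_nonneg[of "T t f - k"]]
      add_mono[OF add_neg_part_nonneg[of "T t f - k"] neg_part_nonneg[of "T t f - h"]]
    by (simp_all add: algebra_simps)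
  then have "sup h k \<le> T t f + (?e h t + ?e k t)" by simp
  then have "0 \<le> T t f - sup h k + (?e h t + ?e k t)" by (simp only: diff_add_eq diff_ge_0_iff_ge)
  moreover have "0 \<le> ?e h t + ?e k t" by (simp add: neg_part_nonneg)
  ultimately have "norm (?e (sup h k) t) \<le> norm (?e h t + ?e k t)" by (intro norm_neg_part_le)
  then show "norm (?e (sup h k) t) \<le> norm (?e h t) + norm (?e k t)"
    using norm_triangle_ineq order_trans by blast
qed

lemma lower_bound_limit:
  assumes lim: "u \<longlonglongrightarrow> h" and lb: "\<And>n. lower_bound f (u n)"
  shows "lower_bound f h"
  unfolding is_lower_bound_def
proof
  show "0 \<le> h" by (rule tendsto_nonneg[OF lim]) (simp_all add: lower_boundD(1)[OF lb])
  show "((\<lambda>t. norm (neg_part (T t f - h))) \<longlongrightarrow> 0) (at_top_in J)"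
  proof (rule tendstoI)
    fix e :: real assume "0 < e"
    then obtain n where n: "norm (u n - h) < e / 2"
      using LIMSEQ_D[OF lim, of "e / 2"] by auto
    have "\<forall>\<^sub>F t in at_top_in J. norm (neg_part (T t f - u n)) < e / 2"
      using tendstoD[OF lower_boundD(2)[OF lb[of n]], of "e / 2"] \<open>0 < e\<close> by simp
    then show "\<forall>\<^sub>F t in at_top_in J. dist (norm (neg_part (T t f - h))) 0 < e"
    proof (rule eventually_mono)
      fix t assume "norm (neg_part (T t f - u n)) < e / 2"
      then show "dist (norm (neg_part (T t f - h))) 0 < e"
        using n norm_neg_part_add[of "T t f - u n" "u n - h"] norm_neg_part_le_norm[of "u n - h"]
        by simp
    qed
  qed
qed

lemma lower_bound_apply:
  assumes "lower_bound f h" and s: "s \<in> J" shows "lower_bound f (T s h)"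
proof (rule lower_bound_compare)
  show "0 \<le> T s h" by (rule apply_nonneg[OF s lower_boundD(1)[OF assms(1)]])
  show "((\<lambda>t. M * norm (neg_part (T (t - s) f - h))) \<longlongrightarrow> 0) (at_top_in J)"
    using tendsto_mult[OF tendsto_const
        filterlim_compose[OF lower_boundD(2)[OF assms(1)] filterlim_diff_times[OF s]], of M]
    by simp
  fix t assume t: "t \<in> J" "s < t"
  have "T t f = T s (T (t - s) f)"
    using apply_add[OF diff_times[OF s t] s, of f] by simp
  then have "norm (neg_part (T t f - T s h)) \<le> norm (T s) * norm (neg_part (T (t - s) f - h))"
    using norm_neg_part_positive_operator[OF positive[OF s], of "T (t - s) f - h"]
    by (simp add: blinfun.diff_right)
  also have "\<dots> \<le> M * norm (neg_part (T (t - s) f - h))"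
    by (intro mult_right_mono norm_le s) simp
  finally show "norm (neg_part (T t f - T s h)) \<le> M * norm (neg_part (T (t - s) f - h))" .
qed

text \<open>
  Finite suprema of lower bounds whose norms approach the supremum of all norms increase to a limit
  \<open>l\<close> of maximal norm. Then \<open>sup l k\<close> has the same norm as \<open>l\<close> for every lower bound \<open>k\<close>, so
  the two are equal by additivity of the norm.
\<close>
lemma greatest_lower_bound:
  assumes "lower_bound f k"
  obtains h where "lower_bound f h" "\<And>k. lower_bound f k \<Longrightarrow> k \<le> h"
proof -
  define S where "S = norm ` {h. lower_bound f h}"
  have S: "S \<noteq> {}" "bdd_above S"
    using assms norm_lower_bound_le by (auto simp: S_def intro!: bdd_aboveI)
  have "\<exists>h. lower_bound f h \<and> Sup S - inverse (real (Suc n)) < norm h" for n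
    using less_cSupD[OF S(1), of "Sup S - inverse (real (Suc n))"] by (auto simp: S_def)
  then obtain h where h: "\<And>n. lower_bound f (h n)"
    "\<And>n. Sup S - inverse (real (Suc n)) < norm (h n)"
    by metis
  define u where "u = rec_nat (h 0) (\<lambda>n v. sup v (h (Suc n)))"
  have u_simps: "u 0 = h 0" "\<And>n. u (Suc n) = sup (u n) (h (Suc n))" by (simp_all add: u_def)
  have u: "lower_bound f (u n)" for n
    by (induction n) (simp_all add: u_simps h(1) lower_bound_sup)
  have "h n \<le> u n" for n by (cases n) (simp_all add: u_simps)
  then have norm_u: "Sup S - inverse (real (Suc n)) \<le> norm (u n)" for n
    using h(2)[of n] bl_norm_mono[OF lower_boundD(1)[OF h(1)], of n "u n"] by force
  have "u n \<le> u (Suc n)" for n by (simp add: u_simps)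
  then obtain l where l: "u \<longlonglongrightarrow> l" "\<And>n. u n \<le> l"
    by (rule incseq_bounded_convergent[OF lower_boundD(1)[OF u] _ norm_lower_bound_le[OF u]]) blast
  have lb: "lower_bound f l" by (rule lower_bound_limit[OF l(1) u])
  have "Sup S - 0 \<le> norm l"
    by (rule LIMSEQ_le[OF tendsto_diff[OF tendsto_const LIMSEQ_inverse_real_of_nat]
          tendsto_norm[OF l(1)]]) (use norm_u in blast)
  have "k \<le> l" if k: "lower_bound f k" for k
  proof -
    have "norm (sup l k) \<in> S" using lower_bound_sup[OF lb k] by (simp add: S_def)
    then have "norm (sup l k) \<le> norm l"
      using cSup_upper[OF _ S(2)] \<open>Sup S - 0 \<le> norm l\<close> by fastforce
    then have "norm (sup l k - l) \<le> 0"
      using norm_diff_of_le[OF lower_boundD(1)[OF lb], of "sup l k"] by simp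
    then have "sup l k = l" by (simp only: norm_le_zero_iff right_minus_eq)
    then show "k \<le> l" by (simp only: sup.absorb_iff1)
  qed
  with lb show ?thesis by (rule that)
qed


section \<open>Convergence of orbits\<close>

text \<open>
  Choose a decreasing sequence of vectors \<open>x n\<close> that is mapped at time \<open>n + 1\<close> to the positive part
  of the orbit of \<open>f\<close>. This is possible because the positive part at one time is dominated by
  the image of the positive part at the previous time, so that interval preservation provides
  \<open>x (Suc n)\<close> below \<open>x n\<close>. After time \<open>n + 1\<close> the orbits of \<open>f\<close> and \<open>x n\<close> then differ by at
  most a constant times the norm of the negative part of the former at time \<open>n + 1\<close>.
\<close>
lemma asymptotically_positive_orbit:
  assumes ip: "\<And>t. t \<in> J \<Longrightarrow> almost_interval_preserving (T t)"
    and f: "((\<lambda>t. norm (neg_part (T t f))) \<longlongrightarrow> 0) (at_top_in J)"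
  obtains x where "0 \<le> x" "((\<lambda>t. T t f - T t x) \<longlongrightarrow> 0) (at_top_in J)"
proof -
  let ?t = "\<lambda>n. real (Suc n)"
  note interval_preserving = interval_preserving[OF positive ip, OF nat_in_times nat_in_times]
  have "\<exists>x. \<forall>n. (0 \<le> x n \<and> T (?t n) (x n) = pprt (T (?t n) f)) \<and> x (Suc n) \<le> x n"
  proof (rule dependent_nat_choice)
    have "pprt (T (?t 0) f) \<le> T (?t 0) (pprt f)"
      by (rule pprt_positive_operator_le[OF positive[OF nat_in_times]])
    then show "\<exists>x. 0 \<le> x \<and> T (?t 0) x = pprt (T (?t 0) f)"
      using interval_preserving[OF zero_le_pprt zero_le_pprt] by metis
  next
    fix x n
    assume x: "0 \<le> x \<and> T (?t n) x = pprt (T (?t n) f)"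
    have step: "T (?t (Suc n)) g = T 1 (T (?t n) g)" for g
      using apply_add[OF nat_in_times[of n] nat_in_times[of 0], of g] by simp
    have "positive_operator (T 1)" using positive[OF nat_in_times[of 0]] by simp
    then have "pprt (T (?t (Suc n)) f) \<le> T (?t (Suc n)) x"
      using pprt_positive_operator_le[of "T 1" "T (?t n) f"] x by (simp only: step)
    then show "\<exists>y. (0 \<le> y \<and> T (?t (Suc n)) y = pprt (T (?t (Suc n)) f)) \<and> y \<le> x"
      using interval_preserving[OF _ zero_le_pprt] x by metis
  qed
  then obtain x where x: "\<And>n. 0 \<le> x n" "\<And>n. x (Suc n) \<le> x n"
    "\<And>n. T (?t n) (x n) = pprt (T (?t n) f)"
    by blast
  obtain l where l: "x \<longlonglongrightarrow> l" "0 \<le> l" "\<And>n. l \<le> x n"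
    using decseq_nonneg_convergent[of x] x(1,2) by blast
  define b where "b n = M * norm (neg_part (T (?t n) f)) + M * norm (x n - l)" for n
  have "b \<longlonglongrightarrow> M * 0 + M * 0"
    unfolding b_def
    by (intro tendsto_add tendsto_mult tendsto_const filterlim_compose[OF f filterlim_nat_times]
        tendsto_norm_zero LIM_zero l(1))
  have le: "norm (T t f - T t l) \<le> b n" if t: "t \<in> J" "?t n < t" for t n
  proof -
    have s: "t - ?t n \<in> J" by (rule diff_times[OF nat_in_times t])
    have "T t g = T (t - ?t n) (T (?t n) g)" for g
      using apply_add[OF nat_in_times[of n] s, of g] by simp
    then have "T t f - T t (x n) = - T (t - ?t n) (neg_part (T (?t n) f))"
      by (simp add: x(3) pprt_eq_add_neg_part blinfun.add_right del: of_nat_Suc)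
    then have "T t f - T t l = - T (t - ?t n) (neg_part (T (?t n) f)) + T t (x n - l)"
      by (simp add: blinfun.diff_right algebra_simps)
    then show ?thesis
      using norm_triangle_ineq[of "- T (t - ?t n) (neg_part (T (?t n) f))" "T t (x n - l)"]
        norm_apply_le[OF s] norm_apply_le[OF t(1)]
      unfolding b_def by (smt (verit) norm_minus_cancel)
  qed
  have "((\<lambda>t. T t f - T t l) \<longlongrightarrow> 0) (at_top_in J)"
  proof (rule tendstoI)
    fix e :: real assume "0 < e"
    then obtain n where n: "b n < e"
      using order_tendstoD(2)[OF \<open>b \<longlonglongrightarrow> _\<close>, of e] by (auto simp: eventually_sequentially)
    show "\<forall>\<^sub>F t in at_top_in J. dist (T t f - T t l) 0 < e"
      using eventually_in_times[of "?t n"]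
    proof (rule eventually_mono)
      fix t assume "t \<in> J \<and> ?t n < t"
      then show "dist (T t f - T t l) 0 < e" using le[of t n] n by simp
    qed
  qed
  with l(2) show ?thesis by (rule that)
qed

context
  assumes lower_bounds: "\<And>f. 0 < f \<Longrightarrow> \<exists>h. h \<noteq> 0 \<and> lower_bound f h"
begin

lemma zero_if_orbit_vanishes:
  assumes "0 \<le> f" "filterlim r (at_top_in J) sequentially" "(\<lambda>n. T (r n) f) \<longlonglongrightarrow> 0"
  shows "f = 0"
proof (rule ccontr)
  assume "f \<noteq> 0"
  with assms(1) obtain h where h: "h \<noteq> 0" "lower_bound f h"
    using lower_bounds[of f] by (auto simp: order_less_le)
  have "(\<lambda>n. norm (T (r n) f) + norm (neg_part (T (r n) f - h))) \<longlonglongrightarrow> 0"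
    using tendsto_add[OF tendsto_norm_zero[OF assms(3)]
        filterlim_compose[OF lower_boundD(2)[OF h(2)] assms(2)]] by simp
  then have "norm h \<le> 0"
    by (rule LIMSEQ_le_const)
      (use norm_lower_bound_le_apply[OF lower_boundD(1)[OF h(2)]] in blast)
  with h(1) show False by simp
qed

text \<open>
  Along the multiples of \<open>s\<close> the orbit of \<open>h\<close> is decreasing and so converges. Hence the
  orbit of \<open>h - T s h\<close>, which consists of its consecutive differences, tends to zero.
\<close>
lemma fixed_if_subinvariant:
  assumes "0 \<le> h" and s: "s \<in> J" and "T s h \<le> h"
  shows "T s h = h"
proof -
  let ?r = "\<lambda>n. real (Suc n) * s"
  have step: "T (?r (Suc n)) h = T (?r n) (T s h)" for n
    using apply_add[OF s mult_times[OF s, of n], of h] by (simp add: algebra_simps)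
  have "T (?r (Suc n)) h \<le> T (?r n) h" for n
    unfolding step by (rule apply_mono[OF mult_times[OF s] assms(3)])
  then obtain l where l: "(\<lambda>n. T (?r n) h) \<longlonglongrightarrow> l"
    using decseq_nonneg_convergent[of "\<lambda>n. T (?r n) h"] apply_nonneg[OF mult_times[OF s] assms(1)]
    by blast
  have "(\<lambda>n. T (?r n) h - T (?r (Suc n)) h) \<longlonglongrightarrow> l - l"
    by (intro tendsto_diff l LIMSEQ_Suc[OF l])
  then have "(\<lambda>n. T (?r n) (h - T s h)) \<longlonglongrightarrow> 0"
    by (simp only: step blinfun.diff_right diff_self)
  then have "h - T s h = 0"
    using assms(3) by (intro zero_if_orbit_vanishes[OF _ filterlim_mult_times[OF s]]) simp_all
  then show ?thesis by simp
qed

text \<open>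
  The greatest lower bound \<open>h\<close> of \<open>g\<close> is subinvariant, hence fixed. The orbit of \<open>g - h\<close> is
  asymptotic to that of some \<open>x \<ge> 0\<close>; a nonzero lower bound \<open>w\<close> of \<open>x\<close> would make \<open>h + w\<close> a
  lower bound of \<open>g\<close>.
\<close>
lemma positive_orbit_converges:
  assumes ip: "\<And>t. t \<in> J \<Longrightarrow> almost_interval_preserving (T t)" and g: "0 \<le> g"
  obtains h where "((\<lambda>t. T t g) \<longlongrightarrow> h) (at_top_in J)"
proof -
  have "lower_bound g 0"
    by (rule lower_bound_compare[where e = "\<lambda>_. 0" and s = 0])
      (simp_all add: apply_nonneg g neg_part_of_nonneg)
  then obtain h where h: "lower_bound g h" "\<And>k. lower_bound g k \<Longrightarrow> k \<le> h"
    by (rule greatest_lower_bound) blast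
  have fixed: "T s h = h" if "s \<in> J" for s
    by (rule fixed_if_subinvariant[OF lower_boundD(1)[OF h(1)] that
          h(2)[OF lower_bound_apply[OF h(1) that]]])
  define f where "f = g - h"
  have f: "T t f = T t g - h" if "t \<in> J" for t
    by (simp add: f_def blinfun.diff_right fixed that)
  have "((\<lambda>t. norm (neg_part (T t f))) \<longlongrightarrow> 0) (at_top_in J)"
    using lower_boundD(2)[OF h(1)]
  proof (rule Lim_transform_eventually)
    show "\<forall>\<^sub>F t in at_top_in J. norm (neg_part (T t g - h)) = norm (neg_part (T t f))"
      using eventually_in_times[of 0] by (rule eventually_mono) (simp add: f)
  qed
  then obtain x where x: "0 \<le> x" "((\<lambda>t. T t f - T t x) \<longlongrightarrow> 0) (at_top_in J)"
    using asymptotically_positive_orbit[OF ip] by blast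
  have "x = 0"
  proof (rule ccontr)
    assume "x \<noteq> 0"
    with x(1) obtain w where w: "w \<noteq> 0" "lower_bound x w"
      using lower_bounds[of x] by (auto simp: order_less_le)
    have "lower_bound g (h + w)"
    proof (rule lower_bound_compare)
      show "0 \<le> h + w" using lower_boundD(1) h(1) w(2) by (intro add_nonneg_nonneg)
      show "((\<lambda>t. norm (T t f - T t x) + norm (neg_part (T t x - w))) \<longlongrightarrow> 0) (at_top_in J)"
        using tendsto_add[OF tendsto_norm_zero[OF x(2)] lower_boundD(2)[OF w(2)]] by simp
      fix t assume t: "t \<in> J"
      have "T t g - (h + w) = (T t f - T t x) + (T t x - w)" by (simp add: f t)
      then have "norm (neg_part (T t g - (h + w)))
          \<le> norm (neg_part (T t f - T t x)) + norm (neg_part (T t x - w))"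
        by (simp only: norm_neg_part_add)
      also have "\<dots> \<le> norm (T t f - T t x) + norm (neg_part (T t x - w))"
        by (rule add_right_mono) (rule norm_neg_part_le_norm)
      finally show "norm (neg_part (T t g - (h + w)))
          \<le> norm (T t f - T t x) + norm (neg_part (T t x - w))" .
    qed
    then have "w \<le> 0" using h(2)[of "h + w"] by simp
    with w lower_boundD(1)[OF w(2)] show False by simp
  qed
  have "((\<lambda>t. T t g) \<longlongrightarrow> h) (at_top_in J)"
  proof (rule LIM_zero_cancel, rule Lim_transform_eventually)
    show "((\<lambda>t. T t f - T t x) \<longlongrightarrow> 0) (at_top_in J)" by fact
    show "\<forall>\<^sub>F t in at_top_in J. T t f - T t x = T t g - h"
      using eventually_in_times[of 0] by (rule eventually_mono) (simp add: f \<open>x = 0\<close>)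
  qed
  then show ?thesis by (rule that)
qed

lemma strongly_convergent:
  assumes ip: "\<And>t. t \<in> J \<Longrightarrow> almost_interval_preserving (T t)"
  obtains P where "strongly_converges_to J T P"
proof -
  have "\<exists>h. ((\<lambda>t. T t f) \<longlongrightarrow> h) (at_top_in J)" for f
  proof -
    obtain h k where "((\<lambda>t. T t (pprt f)) \<longlongrightarrow> h) (at_top_in J)"
      "((\<lambda>t. T t (- nprt f)) \<longlongrightarrow> k) (at_top_in J)"
      using positive_orbit_converges[OF ip] zero_le_pprt nprt_le_zero neg_0_le_iff_le by metis
    then have "((\<lambda>t. T t (pprt f) - T t (- nprt f)) \<longlongrightarrow> h - k) (at_top_in J)"
      by (rule tendsto_diff)
    moreover have "T t (pprt f) - T t (- nprt f) = T t f" for t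
      using prts[of f] by (metis blinfun.diff_right diff_minus_eq_add)
    ultimately show ?thesis by auto
  qed
  then obtain Q where Q: "\<And>f. ((\<lambda>t. T t f) \<longlongrightarrow> Q f) (at_top_in J)" by metis
  have "bounded_linear Q"
  proof (rule bounded_linear_intro[where K = M])
    show "Q (f + g) = Q f + Q g" for f g
      using tendsto_unique[OF at_top_in_neq_bot Q[of "f + g"]] tendsto_add[OF Q[of f] Q[of g]]
      by (simp add: blinfun.add_right)
    show "Q (c *\<^sub>R f) = c *\<^sub>R Q f" for c f
      using tendsto_unique[OF at_top_in_neq_bot Q[of "c *\<^sub>R f"]]
        tendsto_scaleR[OF tendsto_const Q[of f], of c]
      by (simp add: blinfun.scaleR_right)
    show "norm (Q f) \<le> norm f * M" for f
    proof (rule tendsto_upperbound[OF tendsto_norm[OF Q] _ at_top_in_neq_bot])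
      show "\<forall>\<^sub>F t in at_top_in J. norm (T t f) \<le> norm f * M"
        using eventually_in_times[of 0]
        by (rule eventually_mono) (simp add: norm_apply_le mult.commute[of "norm f"])
    qed
  qed
  then have "strongly_converges_to J T (Blinfun Q)"
    using Q by (simp add: strongly_converges_to_def bounded_linear_Blinfun_apply)
  then show ?thesis by (rule that)
qed

end

lemma limit_ge_lower_bound:
  assumes "strongly_converges_to J T P" "lower_bound f h"
  shows "h \<le> P f"
proof -
  have "((\<lambda>t. norm (neg_part (T t f - h))) \<longlongrightarrow> norm (neg_part (P f - h))) (at_top_in J)"
    using assms(1) unfolding strongly_converges_to_def
    by (intro tendsto_norm_neg_part tendsto_diff tendsto_const) blast
  then have "norm (neg_part (P f - h)) = 0"
    by (rule tendsto_unique[OF at_top_in_neq_bot _ lower_boundD(2)[OF assms(2)]])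
  then show ?thesis using nonneg_if_norm_neg_part_zero[of "P f - h"] by simp
qed

lemma limit_is_lower_bound:
  assumes "strongly_converges_to J T P" "0 \<le> P f"
  shows "lower_bound f (P f)"
proof (rule lower_bound_compare[where s = 0, OF assms(2)])
  show "((\<lambda>t. norm (T t f - P f)) \<longlongrightarrow> 0) (at_top_in J)"
    using assms(1) unfolding strongly_converges_to_def
    by (intro tendsto_norm_zero LIM_zero) blast
qed (rule norm_neg_part_le_norm)

end

section \<open>Lower bounds characterize strong convergence\<close>
theorem theorem5p1:
  fixes J :: "real set" and T :: "real \<Rightarrow> 'a::al_space \<Rightarrow>\<^sub>L 'a"
  assumes "J = real ` {1..} \<or> J = {0<..}"
    and "operator_semigroup J T"
    and "bounded (T ` J)"
    and "positive_family J T"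
    and "\<And>t. t \<in> J \<Longrightarrow> dual_lattice_hom (dual_operator (T t))"
  shows "(\<exists>P. strongly_converges_to J T P \<and> (\<forall>f>0. P f > 0)) \<longleftrightarrow>
         (\<forall>f>0. \<exists>h. h \<noteq> 0 \<and> is_lower_bound J T f h)"
proof -
  obtain M where "\<And>t. t \<in> J \<Longrightarrow> norm (T t) \<le> M"
    using assms(3) by (auto simp: bounded_iff)
  then interpret bounded_positive_semigroup J T M
    using assms(1,2,4)
    by unfold_locales
      (simp_all add: operator_semigroup_def positive_family_def positive_operator_def)
  show ?thesis
  proof
    assume "\<exists>P. strongly_converges_to J T P \<and> (\<forall>f>0. P f > 0)"
    then obtain P where P: "strongly_converges_to J T P" "\<And>f. 0 < f \<Longrightarrow> 0 < P f" by blast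
    show "\<forall>f>0. \<exists>h. h \<noteq> 0 \<and> is_lower_bound J T f h"
    proof (intro allI impI)
      fix f :: 'a assume "0 < f"
      from P(2)[OF this] limit_is_lower_bound[OF P(1), of f]
      show "\<exists>h. h \<noteq> 0 \<and> is_lower_bound J T f h" by (intro exI[of _ "P f"]) auto
    qed
  next
    assume lb: "\<forall>f>0. \<exists>h. h \<noteq> 0 \<and> is_lower_bound J T f h"
    then have lower_bounds: "\<exists>h. h \<noteq> 0 \<and> is_lower_bound J T f h" if "0 < f" for f
      using that by blast
    obtain P where P: "strongly_converges_to J T P"
    proof (rule strongly_convergent[OF lower_bounds])
      show "almost_interval_preserving (T t)" if "t \<in> J" for t
        by (rule almost_interval_preserving_if_dual_lattice_hom[OF assms(5)[OF that]])
    qed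
    have "0 < P f" if "0 < f" for f
    proof -
      obtain h where h: "h \<noteq> 0" "is_lower_bound J T f h" using lower_bounds \<open>0 < f\<close> by blast
      then have "0 < h" using lower_boundD(1) by (simp add: order_less_le)
      also have "h \<le> P f" by (rule limit_ge_lower_bound[OF P h(2)])
      finally show ?thesis .
    qed
    with P show "\<exists>P. strongly_converges_to J T P \<and> (\<forall>f>0. P f > 0)" by blast
  qed
qed

end
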